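(* Let $n \geq 3$ and let $\mathcal{S}$ be the bi-coloured system derived from a positively edge-weighted tree $T$ on $n$ vertices. Then $$m_{\mathcal{S}} \geq \begin{cases} \left\lfloor \frac{n^2}{4} + n + 1 \right\rfloor & \text{if } n \geq 6, \\ \binom{n}{2} + 1 & \text{if } n \leq 6. \end{cases}$$ Equality holds if and only if (1) $n \leq 6$ and $T$ is a path; or (2) $n \geq 6$ and $T = S(a^*, n-a^* )$, where $a^* = (n-1)/2$ if $n$ is odd, and $a^* = n/2 - 1$ or $a^* = n/2$ if $n$ is even. (Here equality of $T$ with a path or with $S(p,q)$ means isomorphism of the underlying unweighted trees.)
   Context: For a set $V$, $\binom{V}{k}$ denotes the family of $k$-element subsets of $V$. A bi-coloured system is a pair $\mathcal{S} = (V,f)$ where $V$ is a finite set of points and $f : \binom{V}{3} \to \{R,B\}$ is a function. For $\{u,v\} \in \binom{V}{2}$, the red line and blue line generated by $u,v$ are $$R_{\mathcal{S}}(uv) = \{u,v\} \cup \{p : f(\{u,v,p\}) = R\}, \qquad B_{\mathcal{S}}(uv) = \{u,v\} \cup \{p : f(\{u,v,p\}) = B\}.$$ Let $m_{\mathcal{S}}(R)$ and $m_{\mathcal{S}}(B)$ be the numbers of distinct red lines and distinct blue lines respectively, and $m_{\mathcal{S}} = m_{\mathcal{S}}(R) + m_{\mathcal{S}}(B)$ (red and blue lines are counted separately, even if a red line and a blue line are equal as sets). The system derived from a positively edge-weighted tree $T$ has as $V$ the vertex set of $T$; with $\rho(x,y)$ the total weight of the unique path between $x$ and $y$, a triple is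 red if and only if its points can be named $a,b,c$ with $\rho(a,b)+\rho(b,c)=\rho(a,c)$ (equivalently, one of the three vertices lies on the path in $T$ between the other two), and blue otherwise. For integers $p \geq 2$, $q \geq 2$, $S(p,q)$ is the tree on $p+q$ vertices consisting of a path with $q$ vertices together with $p$ additional leaves all attached to one and the same end vertex of the path. *)

theory Defs
  imports Complex_Main
begin

datatype colour = Red | Blue

text \<open>
  A system is a point set together with a colouring of its 3-element subsets. The colouring is a
  total function; its values on sets that are not 3-element subsets of the point set are never
  used below.
\<close>

type_synonym 'a system = "'a set \<times> ('a set \<Rightarrow> colour)"

definition line :: "'a system \<Rightarrow> colour \<Rightarrow> 'a \<Rightarrow> 'a \<Rightarrow> 'a set" where
  "line S c u v = {u, v} \<union> {p \<in> fst S - {u, v}. snd S {u, v, p} = c}"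

definition lines :: "'a system \<Rightarrow> colour \<Rightarrow> 'a set set" where
  "lines S c = {line S c u v | u v. u \<in> fst S \<and> v \<in> fst S \<and> u \<noteq> v}"

definition num_lines :: "'a system \<Rightarrow> nat" where
  "num_lines S = card (lines S Red) + card (lines S Blue)"

type_synonym 'a graph = "'a set \<times> 'a set set"

abbreviation verts :: "'a graph \<Rightarrow> 'a set" where "verts \<equiv> fst"
abbreviation edges :: "'a graph \<Rightarrow> 'a set set" where "edges \<equiv> snd"

definition simple_graph :: "'a graph \<Rightarrow> bool" where
  "simple_graph G \<longleftrightarrow> finite (verts G) \<and> (\<forall>e \<in> edges G. e \<subseteq> verts G \<and> card e = 2)"

definition is_path :: "'a graph \<Rightarrow> 'a \<Rightarrow> 'a list \<Rightarrow> 'a \<Rightarrow> bool" where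
  "is_path G u xs v \<longleftrightarrow> xs \<noteq> [] \<and> hd xs = u \<and> last xs = v \<and> distinct xs \<and> set xs \<subseteq> verts G \<and>
     successively (\<lambda>x y. {x, y} \<in> edges G) xs"

definition is_cycle :: "'a graph \<Rightarrow> 'a list \<Rightarrow> bool" where
  "is_cycle G xs \<longleftrightarrow> length xs \<ge> 3 \<and> distinct xs \<and> set xs \<subseteq> verts G \<and>
     successively (\<lambda>x y. {x, y} \<in> edges G) xs \<and> {last xs, hd xs} \<in> edges G"

definition is_tree :: "'a graph \<Rightarrow> bool" where
  "is_tree G \<longleftrightarrow> simple_graph G \<and> verts G \<noteq> {} \<and>
     (\<forall>u \<in> verts G. \<forall>v \<in> verts G. \<exists>xs. is_path G u xs v) \<and> (\<nexists>xs. is_cycle G xs)"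

definition graph_iso :: "'a graph \<Rightarrow> 'b graph \<Rightarrow> bool" where
  "graph_iso G H \<longleftrightarrow> (\<exists>h. bij_betw h (verts G) (verts H) \<and>
     (\<forall>u \<in> verts G. \<forall>v \<in> verts G. {u, v} \<in> edges G \<longleftrightarrow> {h u, h v} \<in> edges H))"

definition path_weight :: "('a set \<Rightarrow> real) \<Rightarrow> 'a list \<Rightarrow> real" where
  "path_weight w xs = (\<Sum>(x, y) \<leftarrow> zip xs (tl xs). w {x, y})"

text \<open>Meaningful for trees, where the path between two vertices is unique.\<close>

definition tree_dist :: "'a graph \<Rightarrow> ('a set \<Rightarrow> real) \<Rightarrow> 'a \<Rightarrow> 'a \<Rightarrow> real" where
  "tree_dist G w u v = path_weight w (THE xs. is_path G u xs v)"

definition derived_system :: "'a graph \<Rightarrow> ('a set \<Rightarrow> real) \<Rightarrow> 'a system" where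
  "derived_system G w = (verts G, \<lambda>t.
     if \<exists>a b c. t = {a, b, c} \<and> tree_dist G w a b + tree_dist G w b c = tree_dist G w a c
     then Red else Blue)"

definition path_graph :: "nat \<Rightarrow> nat graph" where
  "path_graph n = ({..<n}, {{i, Suc i} | i. Suc i < n})"

text \<open>
  The path has the vertices \<open>0, \<dots>, q - 1\<close>; the \<open>p\<close> additional leaves \<open>q, \<dots>, q + p - 1\<close> are attached
  to its end vertex \<open>0\<close>.
\<close>

definition S_tree :: "nat \<Rightarrow> nat \<Rightarrow> nat graph" where
  "S_tree p q = ({..<q + p}, {{i, Suc i} | i. Suc i < q} \<union> {{0, j} | j. q \<le> j \<and> j < q + p})"

end

theory Submission
  imports Defs
begin

text \<open>
  A red line \<open>R(uv)\<close> of a tree misses exactly the branches that hang off interior vertices of the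
  path from \<open>u\<close> to \<open>v\<close>, and the blue line is \<open>{u, v}\<close> together with these branches. For leaves \<open>u\<close> and
  \<open>v\<close> the line \<open>R(uv)\<close> is that path, from which \<open>{u, v}\<close> can be read off; with \<open>l \<ge> 3\<close> leaves this
  gives \<open>binom(l, 2) + 1\<close> red lines, the last being the whole vertex set. Two pairs can only generate
  the same blue line if they arise from each other by exchanging leaves with a common neighbour. If
  the leaves have \<open>s\<close> different neighbours, \<open>t\<close> of which carry at least two leaves, there are therefore
  at least \<open>binom(n - l + s, 2) + (l - s) + t\<close> blue lines. When \<open>2 \<le> s < l\<close> the total is smallest, for
  fixed \<open>p = l - s + 1\<close>, if \<open>s = 2\<close> and \<open>t = 1\<close>, which forces \<open>S(p, n - p)\<close>; there the bound is attained, and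
  it equals \<open>(p - (n - 1) / 2)\<^sup>2 + n\<^sup>2 / 4 + n + 3 / 4\<close>. Paths (\<open>l = 2\<close>) have \<open>binom(n, 2) + 1\<close> lines, and the
  cases \<open>s = l\<close> and \<open>s = 1\<close> (stars) have more.
\<close>

section \<open>Paths and distances in trees\<close>

lemma is_path_split:
  assumes "is_path G u (as @ x # bs) v"
  shows "is_path G u (as @ [x]) x" "is_path G x (x # bs) v"
  using assms unfolding is_path_def
  by (auto simp: successively_append_iff hd_append split: if_splits)

lemma is_path_join:
  assumes "is_path G u (as @ [x]) x" "is_path G x (x # bs) v" "set as \<inter> set bs = {}"
  shows "is_path G u (as @ x # bs) v"
  using assms unfolding is_path_def
  by (auto simp: successively_append_iff hd_append split: if_splits)

lemma is_path_rev: "is_path G u xs v \<Longrightarrow> is_path G v (rev xs) u"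
  unfolding is_path_def
  by (auto simp: hd_rev last_rev insert_commute)

lemma is_path_ConsE:
  assumes "is_path G u xs v"
  obtains bs where "xs = u # bs"
  using assms unfolding is_path_def by (metis list.collapse)

lemma first_common:
  assumes "set xs \<inter> A \<noteq> {}"
  obtains as m bs where "xs = as @ m # bs" "m \<in> A" "set as \<inter> A = {}"
proof -
  have "\<exists>x \<in> set xs. x \<in> A" using assms by auto
  then obtain as m bs where "xs = as @ m # bs" "m \<in> A" "\<forall>y\<in>set as. y \<notin> A"
    using split_list_first_prop[of xs "\<lambda>x. x \<in> A"] by blast
  then show thesis by (intro that) auto
qed

text \<open>If the paths left \<open>u\<close> along different edges, the first one up to its first
  vertex \<open>m\<close> on the second, followed by the second backwards from \<open>m\<close>,
  would close to a cycle. So they share a step, and induction handles the rest.\<close>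

lemma path_unique:
  assumes "\<nexists>xs. is_cycle G xs"
  shows "is_path G u xs v \<Longrightarrow> is_path G u ys v \<Longrightarrow> xs = ys"
proof (induction xs arbitrary: u ys)
  case Nil
  then show ?case by (simp add: is_path_def)
next
  case (Cons a xs)
  have a: "a = u" using Cons.prems(1) by (simp add: is_path_def)
  obtain ys' where ys: "ys = u # ys'" using Cons.prems(2) by (rule is_path_ConsE)
  show ?case
  proof (cases "xs = [] \<or> ys' = []")
    case True
    then have "u = v" using Cons.prems a ys by (auto simp: is_path_def)
    then have "xs = []" "ys' = []" using Cons.prems a ys
      by (auto simp: is_path_def split: if_splits)
    then show ?thesis using a ys by simp
  next
    case False
    have px: "is_path G (hd xs) xs v" and py: "is_path G (hd ys') ys' v"
      and ex: "{u, hd xs} \<in> edges G" and ey: "{u, hd ys'} \<in> edges G"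
      using False Cons.prems a ys by (auto simp: is_path_def successively_Cons)
    have u: "u \<notin> set xs" "u \<notin> set ys'" "u \<in> verts G"
      using False Cons.prems a ys by (auto simp: is_path_def)
    have "v \<in> set xs \<inter> set ys'" using px py by (metis IntI is_path_def last_in_set)
    then obtain as m bs where m: "xs = as @ m # bs" "m \<in> set ys'" "set as \<inter> set ys' = {}"
      by (metis empty_iff first_common)
    obtain cs ds where c: "ys' = cs @ m # ds" using m(2) by (meson split_list)
    have "hd xs = hd ys'"
    proof (rule ccontr)
      assume ne: "hd xs \<noteq> hd ys'"
      have 1: "successively (\<lambda>x y. {x, y} \<in> edges G) (as @ [m])"
        using px m(1) by (auto simp: is_path_def successively_append_iff)
      have 2: "successively (\<lambda>x y. {x, y} \<in> edges G) (m # rev cs)"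
      proof -
        have "successively (\<lambda>x y. {x, y} \<in> edges G) (cs @ [m])"
          using py c by (auto simp: is_path_def successively_append_iff)
        then have "successively (\<lambda>x y. {y, x} \<in> edges G) (cs @ [m])"
          by (simp add: insert_commute)
        then have "successively (\<lambda>x y. {x, y} \<in> edges G) (rev (cs @ [m]))"
          unfolding successively_rev by simp
        then show ?thesis by simp
      qed
      have "is_cycle G (u # as @ m # rev cs)"
        unfolding is_cycle_def
      proof (intro conjI)
        \<comment> \<open>If \<open>as\<close> and \<open>cs\<close> were both empty,
          \<open>m\<close> would be the first vertex of both tails, against
          \<open>ne\<close>.\<close>
        show "3 \<le> length (u # as @ m # rev cs)" using ne m c by (cases as; cases cs) auto
        show "distinct (u # as @ m # rev cs)" using u m c px py by (auto simp: is_path_def)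
        show "set (u # as @ m # rev cs) \<subseteq> verts G" using u m c px py by (auto simp: is_path_def)
        show "successively (\<lambda>x y. {x, y} \<in> edges G) (u # as @ m # rev cs)"
          using 1 2 ex m(1) by (cases as) (auto simp: successively_append_iff successively_Cons hd_append)
        show "{last (u # as @ m # rev cs), hd (u # as @ m # rev cs)} \<in> edges G"
          using ey c by (cases cs) (auto simp: insert_commute)
      qed
      then show False using assms by blast
    qed
    then have "xs = ys'" using Cons.IH px py by metis
    then show ?thesis using a ys by simp
  qed
qed

section \<open>Weights of paths, and distances in a tree\<close>

lemma path_weight_simps [simp]:
  "path_weight w [] = 0" "path_weight w [x] = 0"
  "path_weight w (x # y # xs) = w {x, y} + path_weight w (y # xs)"
  by (auto simp: path_weight_def)

lemma path_weight_append: "path_weight w (as @ x # bs) = path_weight w (as @ [x]) + path_weight w (x # bs)"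
proof (induction as)
  case (Cons a as)
  then show ?case by (cases as) auto
qed simp

lemma path_weight_rev: "path_weight w (rev xs) = path_weight w xs"
proof (induction xs)
  case (Cons a xs)
  show ?case
  proof (cases xs)
    case (Cons b ys)
    then have "path_weight w (rev (a # xs)) = path_weight w (rev xs) + path_weight w [b, a]"
      using path_weight_append[of w "rev ys" b "[a]"] by simp
    then show ?thesis using Cons.IH Cons by (simp add: insert_commute)
  qed simp
qed simp

lemma path_weight_nonneg:
  assumes "\<forall>e \<in> E. w e > 0" "successively (\<lambda>x y. {x, y} \<in> E) xs"
  shows "path_weight w xs \<ge> 0 \<and> (length xs \<ge> 2 \<longrightarrow> path_weight w xs > 0)"
  using assms(2)
proof (induction xs rule: induct_list012)
  case (3 x y zs)
  then have "path_weight w (y # zs) \<ge> 0" "w {x, y} > 0" using assms(1) by auto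
  then show ?case by simp
qed auto

lemma path_weight_one: "xs \<noteq> [] \<Longrightarrow> path_weight (\<lambda>_. 1) xs = real (length xs) - 1"
  by (induction xs rule: induct_list012) auto

definition tpath :: "'a graph \<Rightarrow> 'a \<Rightarrow> 'a \<Rightarrow> 'a list" where
  "tpath G u v = (THE xs. is_path G u xs v)"

lemma tree_dist_tpath: "tree_dist G w u v = path_weight w (tpath G u v)"
  by (simp add: tree_dist_def tpath_def)

locale tree =
  fixes G :: "'a graph"
  assumes tree: "is_tree G"
begin

abbreviation "V \<equiv> verts G"

lemma tpath_eq: "is_path G u xs v \<Longrightarrow> tpath G u v = xs"
  unfolding tpath_def using tree path_unique[of G] by (intro the_equality) (auto simp: is_tree_def)

lemma is_path_tpath: "u \<in> V \<Longrightarrow> v \<in> V \<Longrightarrow> is_path G u (tpath G u v) v"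
  using tree tpath_eq unfolding is_tree_def by metis

lemma tpath_rev: "u \<in> V \<Longrightarrow> v \<in> V \<Longrightarrow> tpath G v u = rev (tpath G u v)"
  using is_path_tpath is_path_rev tpath_eq by metis

lemma tpath_split:
  assumes "u \<in> V" "v \<in> V" "x \<in> set (tpath G u v)"
  obtains as bs where "tpath G u x = as @ [x]" "tpath G x v = x # bs" "tpath G u v = as @ x # bs"
proof -
  obtain as bs where 1: "tpath G u v = as @ x # bs" using assms by (meson split_list)
  then have "is_path G u (as @ x # bs) v" using assms is_path_tpath by metis
  from is_path_split[OF this] show thesis using 1 that tpath_eq by blast
qed

lemma tpath_verts: "u \<in> V \<Longrightarrow> v \<in> V \<Longrightarrow> x \<in> set (tpath G u v) \<Longrightarrow> x \<in> V"
  using is_path_tpath unfolding is_path_def by blast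

lemma ends_in_tpath: "u \<in> V \<Longrightarrow> v \<in> V \<Longrightarrow> u \<in> set (tpath G u v) \<and> v \<in> set (tpath G u v)"
  using is_path_tpath unfolding is_path_def by (metis hd_in_set last_in_set)

lemma tree_dist_add:
  assumes "u \<in> V" "v \<in> V" "x \<in> set (tpath G u v)"
  shows "tree_dist G w u v = tree_dist G w u x + tree_dist G w x v"
proof -
  obtain as bs where "tpath G u x = as @ [x]" "tpath G x v = x # bs" "tpath G u v = as @ x # bs"
    using assms by (rule tpath_split)
  then show ?thesis unfolding tree_dist_tpath by (simp only: path_weight_append[of w as x bs])
qed

lemma tree_dist_sym: "u \<in> V \<Longrightarrow> v \<in> V \<Longrightarrow> tree_dist G w u v = tree_dist G w v u"
  unfolding tree_dist_tpath by (metis tpath_rev path_weight_rev)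

lemma tree_dist_pos:
  assumes "u \<in> V" "v \<in> V" "u \<noteq> v" "\<forall>e \<in> edges G. w e > 0"
  shows "tree_dist G w u v > 0"
proof -
  have p: "is_path G u (tpath G u v) v" using assms is_path_tpath by blast
  then have "length (tpath G u v) \<ge> 2"
    using assms(3) unfolding is_path_def
    by (cases "tpath G u v"; cases "tl (tpath G u v)") auto
  then show ?thesis unfolding tree_dist_tpath
    using path_weight_nonneg[OF assms(4)] p unfolding is_path_def by blast
qed

text \<open>Walk from \<open>x\<close> towards \<open>u\<close> and stop at the first vertex
  \<open>m\<close> of the path from \<open>u\<close> to \<open>v\<close>. The walked part meets that
  path only in \<open>m\<close>, so it joins with the piece from \<open>m\<close> to
  \<open>v\<close>.\<close>

lemma median:
  assumes "u \<in> V" "v \<in> V" "x \<in> V"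
  obtains m where "m \<in> V" "m \<in> set (tpath G u v)" "m \<in> set (tpath G u x)" "m \<in> set (tpath G x v)"
proof -
  have "set (tpath G x u) \<inter> set (tpath G u v) \<noteq> {}" using assms ends_in_tpath by blast
  then obtain as m bs where m: "tpath G x u = as @ m # bs" "m \<in> set (tpath G u v)"
      "set as \<inter> set (tpath G u v) = {}"
    by (rule first_common)
  obtain cs ds where c: "tpath G u m = cs @ [m]" "tpath G m v = m # ds" "tpath G u v = cs @ m # ds"
    using m(2) assms tpath_split by metis
  have mV: "m \<in> V" using m assms tpath_verts by blast
  have "is_path G x (as @ [m]) m" using m(1) assms is_path_tpath is_path_split(1) by metis
  moreover have "is_path G m (m # ds) v" using c(2) mV assms is_path_tpath by metis
  moreover have "set as \<inter> set ds = {}" using m c by auto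
  ultimately have "tpath G x v = as @ m # ds" using is_path_join tpath_eq by metis
  then have "m \<in> set (tpath G x v)" by simp
  moreover have "m \<in> set (tpath G u x)" using tpath_rev[of x u] m(1) assms by simp
  ultimately show thesis using m mV that by blast
qed

text \<open>Splitting the three distances at the median \<open>m\<close>, the equation says that
  twice the distance of \<open>x\<close> and \<open>m\<close> is zero, and positive weights give
  \<open>x = m\<close>. The right-hand side does not mention \<open>w\<close>: collinearity is
  independent of the weights.\<close>

lemma tree_dist_add_iff:
  assumes "u \<in> V" "v \<in> V" "x \<in> V" "\<forall>e \<in> edges G. w e > 0"
  shows "tree_dist G w u x + tree_dist G w x v = tree_dist G w u v \<longleftrightarrow> x \<in> set (tpath G u v)"
proof
  assume eq: "tree_dist G w u x + tree_dist G w x v = tree_dist G w u v"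
  obtain m where m: "m \<in> V" "m \<in> set (tpath G u v)" "m \<in> set (tpath G u x)" "m \<in> set (tpath G x v)"
    using assms median by metis
  have "tree_dist G w m x = tree_dist G w x m" using m assms tree_dist_sym by blast
  then have "tree_dist G w x m = 0"
    using eq m assms tree_dist_add[of u v m w] tree_dist_add[of u x m w] tree_dist_add[of x v m w]
    by simp
  then have "x = m" using assms m tree_dist_pos[of x m w] by force
  then show "x \<in> set (tpath G u v)" using m by simp
qed (use assms tree_dist_add in force)

text \<open>The number of edges of the path. As the colours do not depend on the weights, this
  distance determines them too, and adjacency becomes distance one.\<close>

definition gdist :: "'a \<Rightarrow> 'a \<Rightarrow> nat" where
  "gdist u v = length (tpath G u v) - 1"

lemma gdist_tree_dist: "u \<in> V \<Longrightarrow> v \<in> V \<Longrightarrow> real (gdist u v) = tree_dist G (\<lambda>_. 1) u v"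
  unfolding gdist_def tree_dist_tpath
  using path_weight_one[of "tpath G u v"] is_path_tpath[of u v]
  by (cases "tpath G u v") (auto simp: is_path_def)

lemma gdist_add_iff:
  assumes "u \<in> V" "v \<in> V" "x \<in> V"
  shows "gdist u v = gdist u x + gdist x v \<longleftrightarrow> x \<in> set (tpath G u v)"
proof -
  have "gdist u v = gdist u x + gdist x v \<longleftrightarrow> real (gdist u x) + real (gdist x v) = real (gdist u v)"
    by linarith
  then show ?thesis using tree_dist_add_iff[OF assms, of "\<lambda>_. 1"] assms by (simp add: gdist_tree_dist)
qed

lemma gdist_sym: "u \<in> V \<Longrightarrow> v \<in> V \<Longrightarrow> gdist u v = gdist v u"
  unfolding gdist_def by (metis tpath_rev length_rev)

lemma gdist_0: "u \<in> V \<Longrightarrow> v \<in> V \<Longrightarrow> gdist u v = 0 \<longleftrightarrow> u = v"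
proof
  assume "u \<in> V" "v \<in> V" "gdist u v = 0"
  then show "u = v" using tree_dist_pos[of u v "\<lambda>_. 1"] gdist_tree_dist[of u v] by force
next
  assume "u \<in> V" "v \<in> V" "u = v"
  then have "tpath G u v = [u]" by (intro tpath_eq) (auto simp: is_path_def)
  then show "gdist u v = 0" by (simp add: gdist_def)
qed

lemma gdist_1: "u \<in> V \<Longrightarrow> v \<in> V \<Longrightarrow> gdist u v = 1 \<longleftrightarrow> {u, v} \<in> edges G"
proof
  assume *: "u \<in> V" "v \<in> V" "gdist u v = 1"
  have p: "is_path G u (tpath G u v) v" using * is_path_tpath by blast
  have "length (tpath G u v) = Suc (Suc 0)" using * by (simp add: gdist_def)
  then obtain a b where "tpath G u v = [a, b]" by (auto simp: length_Suc_conv)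
  then show "{u, v} \<in> edges G" using p by (auto simp: is_path_def)
next
  assume *: "u \<in> V" "v \<in> V" "{u, v} \<in> edges G"
  then have "u \<noteq> v" using tree by (auto simp: is_tree_def simple_graph_def)
  then have "tpath G u v = [u, v]" using * by (intro tpath_eq) (auto simp: is_path_def)
  then show "gdist u v = 1" by (simp add: gdist_def)
qed

lemma gdist_step:
  assumes "u \<in> V" "v \<in> V" "u \<noteq> v"
  shows "\<exists>z \<in> V. gdist u z = 1 \<and> gdist u v = gdist u z + gdist z v"
proof -
  have p: "is_path G u (tpath G u v) v" using assms is_path_tpath by blast
  then obtain bs where bs: "tpath G u v = u # bs" by (rule is_path_ConsE)
  then obtain z zs where z: "bs = z # zs" using p assms by (cases bs) (auto simp: is_path_def)
  have "{u, z} \<in> edges G" "z \<in> V" using p bs z by (auto simp: is_path_def)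
  moreover have "z \<in> set (tpath G u v)" using bs z by simp
  ultimately show ?thesis using gdist_1 gdist_add_iff assms by metis
qed

lemma set_tpath_split:
  assumes "u \<in> V" "v \<in> V" "x \<in> set (tpath G u v)"
  shows "set (tpath G u v) = set (tpath G u x) \<union> set (tpath G x v)"
proof -
  obtain as bs where "tpath G u x = as @ [x]" "tpath G x v = x # bs" "tpath G u v = as @ x # bs"
    using assms by (rule tpath_split)
  then show ?thesis by simp
qed

text \<open>With \<open>m\<close> the median of \<open>u\<close>, \<open>v\<close> and
  \<open>y\<close>, the path from \<open>u\<close> to \<open>v\<close> runs through \<open>m\<close>
  and is covered by the paths from \<open>y\<close> to \<open>u\<close> and from \<open>y\<close> to
  \<open>v\<close>, so \<open>x\<close> lies on one of these.\<close>

lemma gdist_between: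
  assumes "u \<in> V" "v \<in> V" "x \<in> V" "y \<in> V" "gdist u v = gdist u x + gdist x v"
  shows "gdist u y = gdist u x + gdist x y \<or> gdist v y = gdist v x + gdist x y"
proof -
  have x: "x \<in> set (tpath G u v)" using assms gdist_add_iff by blast
  obtain m where m: "m \<in> V" "m \<in> set (tpath G u v)" "m \<in> set (tpath G u y)" "m \<in> set (tpath G y v)"
    using assms median by metis
  note split = set_tpath_split[OF assms(1,2) m(2)] set_tpath_split[OF assms(1,4) m(3)]
    set_tpath_split[OF assms(4,2) m(4)]
  have "x \<in> set (tpath G u y) \<or> x \<in> set (tpath G y v)" using x split by auto
  then have "gdist u y = gdist u x + gdist x y \<or> gdist y v = gdist y x + gdist x v"
    using assms gdist_add_iff by blast
  moreover have "gdist y v = gdist v y" "gdist y x = gdist x y" "gdist x v = gdist v x"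
    using assms gdist_sym by blast+
  ultimately show ?thesis by linarith
qed

lemma gdist_median:
  assumes "u \<in> V" "v \<in> V" "x \<in> V"
  shows "\<exists>m \<in> V. gdist u v = gdist u m + gdist m v \<and> gdist u x = gdist u m + gdist m x \<and>
     gdist x v = gdist x m + gdist m v"
  using median[OF assms] gdist_add_iff assms by metis

end

section \<open>Tree metrics and the lines they generate\<close>

definition pairs :: "'a set \<Rightarrow> 'a set set" where
  "pairs A = {e. e \<subseteq> A \<and> card e = 2}"

lemma pairs_iff: "e \<in> pairs A \<longleftrightarrow> (\<exists>u v. e = {u, v} \<and> u \<noteq> v \<and> u \<in> A \<and> v \<in> A)"
  by (auto simp: pairs_def card_2_iff)

lemma pairs_doubleton [simp]: "{u, v} \<in> pairs A \<longleftrightarrow> u \<noteq> v \<and> u \<in> A \<and> v \<in> A"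
  by (auto simp: pairs_def card_insert_if)

lemma pairs_mono: "A \<subseteq> B \<Longrightarrow> pairs A \<subseteq> pairs B"
  by (auto simp: pairs_def)

lemma finite_pairs: "finite A \<Longrightarrow> finite (pairs A)"
  by (simp add: pairs_def)

lemma card_pairs: "finite A \<Longrightarrow> card (pairs A) = card A choose 2"
  by (simp add: pairs_def n_subsets)

text \<open>All that the counting needs to know about a tree: medians exist (\<open>med\<close>), a
  vertex between \<open>u\<close> and \<open>v\<close> separates any further vertex from one of them
  (\<open>d_between\<close>), and geodesics can be followed edge by edge (\<open>d_step\<close>).
  The triangle inequality comes out of \<open>med\<close>.\<close>

locale tree_metric =
  fixes V :: "'a set" and d :: "'a \<Rightarrow> 'a \<Rightarrow> nat"
  assumes fin: "finite V"
    and card_V: "card V \<ge> 3"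
    and d_0: "u \<in> V \<Longrightarrow> v \<in> V \<Longrightarrow> d u v = 0 \<longleftrightarrow> u = v"
    and d_sym: "u \<in> V \<Longrightarrow> v \<in> V \<Longrightarrow> d u v = d v u"
    and med: "u \<in> V \<Longrightarrow> v \<in> V \<Longrightarrow> x \<in> V \<Longrightarrow>
      \<exists>m \<in> V. d u v = d u m + d m v \<and> d u x = d u m + d m x \<and> d x v = d x m + d m v"
    and d_between: "u \<in> V \<Longrightarrow> v \<in> V \<Longrightarrow> x \<in> V \<Longrightarrow> y \<in> V \<Longrightarrow> d u v = d u x + d x v \<Longrightarrow>
      d u y = d u x + d x y \<or> d v y = d v x + d x y"
    and d_step: "u \<in> V \<Longrightarrow> v \<in> V \<Longrightarrow> u \<noteq> v \<Longrightarrow> \<exists>z \<in> V. d u z = 1 \<and> d u v = d u z + d z v"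
begin

abbreviation btw :: "'a \<Rightarrow> 'a \<Rightarrow> 'a \<Rightarrow> bool" where
  "btw a b c \<equiv> d a c = d a b + d b c"

abbreviation col :: "'a \<Rightarrow> 'a \<Rightarrow> 'a \<Rightarrow> bool" where
  "col u v p \<equiv> btw u v p \<or> btw v u p \<or> btw u p v"

lemma d_refl: "u \<in> V \<Longrightarrow> d u u = 0"
  by (simp add: d_0)

lemma tri: "x \<in> V \<Longrightarrow> y \<in> V \<Longrightarrow> z \<in> V \<Longrightarrow> d x z \<le> d x y + d y z"
  using med[of x z y] d_sym by force

lemma btw_sym: "u \<in> V \<Longrightarrow> v \<in> V \<Longrightarrow> x \<in> V \<Longrightarrow> btw u x v \<longleftrightarrow> btw v x u"
  using d_sym by (metis add.commute)

lemma col_sym: "u \<in> V \<Longrightarrow> v \<in> V \<Longrightarrow> p \<in> V \<Longrightarrow> col u v p \<longleftrightarrow> col v u p"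
  using btw_sym by blast

lemma edge_cases:
  assumes "u \<in> V" "v \<in> V" "p \<in> V" "d u v = 1"
  shows "btw p u v \<or> btw u v p"
proof -
  obtain m where m: "m \<in> V" "btw u m v" "btw u m p" "btw p m v" using med assms by metis
  then have "d u m = 0 \<or> d m v = 0" using assms by linarith
  then have "m = u \<or> m = v" using m assms d_0 by metis
  then show ?thesis using m by auto
qed

lemma btw_trans:
  assumes "a \<in> V" "b \<in> V" "c \<in> V" "e \<in> V" "btw a b c" "btw a c e"
  shows "btw a b e" "btw b c e"
  using assms tri[of a b e] tri[of b c e] by linarith+

text \<open>As \<open>a\<close> lies between \<open>z\<close> and \<open>e\<close>, it also lies
  between \<open>b\<close> and one of them. If that one is \<open>e\<close>, then \<open>b\<close>
  comes before \<open>a\<close> on the way from \<open>z\<close>.\<close>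

lemma geodesic_btw:
  assumes "a \<in> V" "b \<in> V" "z \<in> V" "e \<in> V" "btw z a e" "btw z b e"
  shows "btw z a b \<or> btw z b a"
proof -
  have "d e b = d b e" "d e a = d a e" "d a b = d b a" using assms d_sym by blast+
  moreover have "btw z a b \<or> btw e a b" using d_between assms by blast
  ultimately show ?thesis using assms(5,6) by linarith
qed

lemma geodesic_col:
  assumes "a \<in> V" "b \<in> V" "p \<in> V" "z \<in> V" "e \<in> V" "btw z a e" "btw z b e" "btw z p e"
  shows "col a b p"
proof -
  have 1: "btw z a b \<or> btw z b a" "btw z a p \<or> btw z p a" "btw z p b \<or> btw z b p"
    using geodesic_btw assms by blast+
  have 2: "d a b = d b a" "d a p = d p a" "d b p = d p b" using assms d_sym by blast+
  show ?thesis
  proof (cases "btw z a b")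
    case True
    then show ?thesis using 1(2,3) 2 by linarith
  next
    case False
    then have "btw z b a" using 1(1) by blast
    then show ?thesis using 1(2,3) 2 by linarith
  qed
qed

text \<open>A function of the unordered pair, so that the red lines are the image of
  \<open>pairs V\<close>. The ends are included automatically, since \<open>col u v p\<close> holds
  for \<open>p = u\<close> and \<open>p = v\<close>.\<close>

definition red_line :: "'a set \<Rightarrow> 'a set" where
  "red_line e = {p \<in> V. \<exists>u \<in> V. \<exists>v \<in> V. e = {u, v} \<and> col u v p}"

definition blue_line :: "'a set \<Rightarrow> 'a set" where
  "blue_line e = e \<union> (V - red_line e)"

lemma red_line_doubleton: "u \<in> V \<Longrightarrow> v \<in> V \<Longrightarrow> red_line {u, v} = {p \<in> V. col u v p}"
  unfolding red_line_def using col_sym by (auto simp: doubleton_eq_iff)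

lemma blue_line_iff:
  "u \<in> V \<Longrightarrow> v \<in> V \<Longrightarrow> p \<in> V \<Longrightarrow> p \<in> blue_line {u, v} \<longleftrightarrow> p = u \<or> p = v \<or> \<not> col u v p"
  unfolding blue_line_def by (auto simp: red_line_doubleton)

lemma red_line_edge: "u \<in> V \<Longrightarrow> v \<in> V \<Longrightarrow> d u v = 1 \<Longrightarrow> red_line {u, v} = V"
proof -
  assume *: "u \<in> V" "v \<in> V" "d u v = 1"
  then have "col u v p" if "p \<in> V" for p using edge_cases[of u v p] btw_sym[of p v u] that by blast
  then show ?thesis using * by (auto simp only: red_line_doubleton)
qed

text \<open>Degree one in terms of betweenness: no geodesic passes through \<open>u\<close>. The
  link to having a single neighbour is made by \<open>leafI\<close> and \<open>nb\<close>.\<close>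

definition leaf :: "'a \<Rightarrow> bool" where
  "leaf u \<longleftrightarrow> u \<in> V \<and> (\<forall>a \<in> V. \<forall>b \<in> V. btw a u b \<longrightarrow> a = u \<or> b = u)"

definition leaves :: "'a set" where "leaves = {u. leaf u}"

definition nb :: "'a \<Rightarrow> 'a" where "nb u = (SOME x. x \<in> V \<and> d u x = 1)"

lemma leaves_subset: "leaves \<subseteq> V"
  by (auto simp: leaves_def leaf_def)

lemma finite_leaves: "finite leaves"
  using leaves_subset fin finite_subset by blast

lemma leavesD: "u \<in> leaves \<Longrightarrow> a \<in> V \<Longrightarrow> b \<in> V \<Longrightarrow> btw a u b \<Longrightarrow> a = u \<or> b = u"
  by (auto simp: leaves_def leaf_def)

lemma other: "u \<in> V \<Longrightarrow> v \<in> V \<Longrightarrow> \<exists>p \<in> V. p \<noteq> u \<and> p \<noteq> v"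
proof (rule ccontr)
  assume "\<not> (\<exists>p \<in> V. p \<noteq> u \<and> p \<noteq> v)"
  then have "V \<subseteq> {u, v}" by auto
  then have "card V \<le> card {u, v}" by (intro card_mono) auto
  then show False using card_V card_insert_le_m1[of 2 "{v}" u] by simp
qed

text \<open>Since \<open>x\<close> and \<open>y\<close> are both adjacent to \<open>u\<close>, the
  median of the three can only be \<open>u\<close>.\<close>

lemma two_neighbours:
  assumes "u \<in> V" "x \<in> V" "y \<in> V" "d u x = 1" "d u y = 1" "x \<noteq> y"
  shows "btw x u y"
proof -
  obtain m where m: "m \<in> V" "btw x m y" "btw x m u" "btw u m y" using med assms by metis
  have "d x u = 1" using assms d_sym by metis
  then have "d x m = 0 \<or> d m u = 0" "d u m = 0 \<or> d m y = 0" using m assms by linarith+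
  then have "m = x \<or> m = u" "m = u \<or> m = y" using m assms d_0 by metis+
  then show ?thesis using m assms by auto
qed

text \<open>If \<open>u\<close> were between \<open>a\<close> and \<open>b\<close>, the first steps
  from \<open>u\<close> towards both would lead to the same neighbour, and going through it directly
  would be a shortcut.\<close>

lemma leafI:
  assumes "u \<in> V" "\<And>x y. x \<in> V \<Longrightarrow> y \<in> V \<Longrightarrow> d u x = 1 \<Longrightarrow> d u y = 1 \<Longrightarrow> x = y"
  shows "u \<in> leaves"
proof -
  have False if ab: "a \<in> V" "b \<in> V" "btw a u b" "a \<noteq> u" "b \<noteq> u" for a b
  proof -
    obtain x y where x: "x \<in> V" "d u x = 1" "btw u x a" and y: "y \<in> V" "d u y = 1" "btw u y b"
      using d_step[of u a] d_step[of u b] assms ab by metis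
    have "x = y" using assms x y by blast
    then have "btw u x b" using y by blast
    moreover have "d a u = d u a" "d a x = d x a" using x ab assms d_sym by blast+
    ultimately show False using x ab tri[of a x b] by simp
  qed
  then show ?thesis using assms by (auto simp: leaves_def leaf_def)
qed

lemma nb:
  assumes "u \<in> leaves"
  shows "nb u \<in> V" "d u (nb u) = 1" "\<And>y. y \<in> V \<Longrightarrow> d u y = 1 \<Longrightarrow> y = nb u"
    "\<And>v. v \<in> V \<Longrightarrow> v \<noteq> u \<Longrightarrow> btw u (nb u) v" "nb u \<notin> leaves"
proof -
  have u: "u \<in> V" using assms leaves_subset by blast
  obtain p where p: "p \<in> V" "p \<noteq> u" using other u by blast
  have "\<exists>x. x \<in> V \<and> d u x = 1" using d_step[of u p] p u by auto
  then have "nb u \<in> V \<and> d u (nb u) = 1" unfolding nb_def by (rule someI_ex)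
  then show 1: "nb u \<in> V" "d u (nb u) = 1" by auto
  show 2: "y = nb u" if "y \<in> V" "d u y = 1" for y
  proof (rule ccontr)
    assume "y \<noteq> nb u"
    then have "btw y u (nb u)" using two_neighbours that 1 u by blast
    then show False using leavesD[OF assms, of y "nb u"] that 1 d_refl u by force
  qed
  show 3: "btw u (nb u) v" if "v \<in> V" "v \<noteq> u" for v
    using d_step[of u v] that u 2 by metis
  obtain p where p: "p \<in> V" "p \<noteq> u" "p \<noteq> nb u" using other u 1 by blast
  then show "nb u \<notin> leaves" using 3[of p] leavesD[of "nb u" u p] 1 d_refl u by force
qed

text \<open>As \<open>u\<close> is off the red line of \<open>u'\<close> and \<open>v'\<close>, it
  is attached to their path at an interior vertex \<open>x\<close>. Everything else hanging at
  \<open>x\<close> lies on the common blue line, so it is an end of the pair \<open>u\<close>,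
  \<open>v\<close> or off their red line. This leaves no room for a vertex between \<open>u\<close>
  and \<open>x\<close>, nor for one behind \<open>u\<close>.\<close>

lemma blue_leaf:
  assumes V: "u \<in> V" "v \<in> V" "u' \<in> V" "v' \<in> V" and ne: "u \<noteq> v" "u' \<noteq> v'"
    and eq: "blue_line {u, v} = blue_line {u', v'}" and u: "u \<noteq> u'" "u \<noteq> v'"
  shows "u \<in> leaves \<and> btw u' (nb u) v' \<and> nb u \<noteq> u' \<and> nb u \<noteq> v'"
proof -
  have ncol: "\<not> col u' v' u" using eq u blue_line_iff V by blast
  obtain x where x: "x \<in> V" "btw u' x v'" "btw u' x u" "btw u x v'" using med V by metis
  have xu': "btw u x u'" and xv': "btw v' x u" using x V btw_sym by blast+
  have xne: "x \<noteq> u" "x \<noteq> u'" "x \<noteq> v'" using ncol x(2,3) xv' by metis+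
  have hang: "y = u \<or> y = v \<or> \<not> col u v y"
    if y: "y \<in> V" "y \<noteq> x" "btw y x u'" "btw y x v'" for y
  proof -
    have "d x y \<noteq> 0" "d x u' \<noteq> 0" "d x v' \<noteq> 0" using y x V xne d_0 by metis+
    moreover have "d u' y = d y u'" "d v' y = d y v'" "d u' v' = d v' u'" "d x u' = d u' x" "d x v' = d v' x"
        "d x y = d y x"
      using y x V d_sym by blast+
    ultimately have "\<not> col u' v' y" using x(2) y(3,4) by linarith
    then show ?thesis using eq blue_line_iff V y by blast
  qed
  \<comment> \<open>An end of the second pair other than \<open>v\<close>: it is on the common blue
    line, hence not collinear with \<open>u\<close> and \<open>v\<close>.\<close>
  obtain t where t: "t \<in> V" "t \<noteq> v" "t \<noteq> u" "btw u x t" "\<not> col u v t"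
  proof (cases "u' = v")
    case False
    then have "\<not> col u v u'" using u V eq blue_line_iff by blast
    then show thesis using that[of u'] False u V xu' by blast
  next
    case True
    then have "\<not> col u v v'" using u V eq blue_line_iff ne by blast
    then show thesis using that[of v'] True ne u V x by blast
  qed
  obtain y where y: "y \<in> V" "d u y = 1" "btw u y x" using d_step[of u x] V x xne by metis
  have yu: "y \<noteq> u" using y V d_refl by force
  have yt: "btw u y t" using btw_trans V x y t by blast
  have yv: "btw u y v"
  proof (rule ccontr)
    assume "\<not> btw u y v"
    then have "btw v u y" using edge_cases[of u y v] V y by blast
    then have "btw v u t \<or> btw y u t" using d_between V y t by blast
    then show False using t yt y V d_sym[of u y] by auto
  qed
  \<comment> \<open>Otherwise \<open>y\<close> would hang at \<open>x\<close> and be collinear with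
    \<open>u\<close> and \<open>v\<close>, so it would be \<open>v\<close>. But the ends of an edge
    are collinear with everything, including \<open>t\<close>.\<close>
  have "y = x"
  proof (rule ccontr)
    assume "y \<noteq> x"
    have "btw y x u'" "btw y x v'"
      using btw_trans[of u y x u'] btw_trans[of u y x v'] V x y xu' by auto
    then have "y = v" using hang[of y] yv yu y \<open>y \<noteq> x\<close> by blast
    then show False using y t edge_cases[of u v t] V btw_sym by blast
  qed
  have ux: "d u x = 1" "btw u x v" using y(2) yv unfolding \<open>y = x\<close> by blast+
  have "False" if ab: "a \<in> V" "b \<in> V" "btw a u b" "a \<noteq> u" "b \<noteq> u" for a b
  proof -
    have "btw a u v \<or> btw b u v" using d_between[of a b u v] ab V by blast
    then obtain p where p: "p \<in> V" "p \<noteq> u" "btw p u v" using ab by blast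
    have xu: "d x u = 1" using ux x V d_sym by metis
    have "d v u = d u v" "d v x = d x v" using V x d_sym by blast+
    then have "\<not> btw v u x" using ux by linarith
    then have pux: "btw p u x" using d_between[of p v u x] p V x by blast
    have pu: "d p u = d u p" "d p x = d x p" using p V x d_sym by blast+
    have "\<not> btw u x p" using pux pu ux by linarith
    then have "btw p x u'" "btw p x v'"
      using d_between[of u u' x p] d_between[of u v' x p] x V p xu' btw_sym by blast+
    moreover have "p \<noteq> x" using pux ux p x V d_refl xu by force
    ultimately have "p = v" using hang[of p] p V btw_sym by blast
    then show False using p V d_refl d_0 by force
  qed
  then have "u \<in> leaves" using V by (auto simp: leaves_def leaf_def)
  moreover have "nb u = x" using nb(3)[OF \<open>u \<in> leaves\<close>, of x] ux x by simp
  ultimately show ?thesis using x xne by blast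
qed

text \<open>By \<open>blue_leaf\<close> both \<open>u\<close> and \<open>u'\<close> are leaves, and
  the neighbour of each lies on the path from the other one to \<open>v\<close>. Adding up
  distances, the two neighbours coincide.\<close>

lemma blue_eq_meet:
  assumes V: "u \<in> V" "v \<in> V" "u' \<in> V" and ne: "u \<noteq> v" "u' \<noteq> v" "u \<noteq> u'"
    and eq: "blue_line {u, v} = blue_line {u', v}"
  shows "u \<in> leaves" "u' \<in> leaves" "nb u = nb u'" "nb u \<noteq> v"
proof -
  note 1 = blue_leaf[OF V(1,2,3,2) ne(1,2) eq ne(3,1)]
    and 2 = blue_leaf[OF V(3,2,1,2) ne(2,1) eq[symmetric] ne(3)[symmetric] ne(2)]
  show l: "u \<in> leaves" "u' \<in> leaves" "nb u \<noteq> v" using 1 2 by auto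
  have xV: "nb u \<in> V" "nb u' \<in> V" using nb l by auto
  have "btw u' (nb u') (nb u)" "btw u (nb u) (nb u')" "btw u' (nb u') v" "btw u (nb u) v"
    using nb(4) l 1 2 xV ne V by metis+
  moreover have "d (nb u) (nb u') = d (nb u') (nb u)" using d_sym xV by blast
  ultimately have "d (nb u) (nb u') = 0" using 1 2 by linarith
  then show "nb u = nb u'" using xV d_0 by blast
qed

text \<open>By \<open>blue_leaf\<close> all four points are leaves, and the neighbours for each pair
  lie between the ends of the other. After stripping off the leaves, \<open>x\<close> and
  \<open>y\<close> lie between \<open>x'\<close> and \<open>y'\<close> and vice versa, so both
  stretches have the same ends, possibly in opposite order.\<close>

lemma blue_eq_disjoint:
  assumes V: "u \<in> V" "v \<in> V" "u' \<in> V" "v' \<in> V" and ne: "u \<noteq> v" "u' \<noteq> v'"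
    and eq: "blue_line {u, v} = blue_line {u', v'}" and u: "u \<noteq> u'" "u \<noteq> v'" "v \<noteq> u'" "v \<noteq> v'"
  shows "u \<in> leaves" "v \<in> leaves" "u' \<in> leaves" "v' \<in> leaves" "{nb u, nb v} = {nb u', nb v'}"
proof -
  note 1 = blue_leaf[OF V ne eq u(1,2)]
  have eq': "blue_line {v, u} = blue_line {u', v'}" using eq by (simp add: insert_commute)
  note 2 = blue_leaf[OF V(2,1,3,4) ne(1)[symmetric] ne(2) eq' u(3,4)]
  note 3 = blue_leaf[OF V(3,4,1,2) ne(2,1) eq[symmetric] u(1)[symmetric] u(3)[symmetric]]
  have eq'': "blue_line {v', u'} = blue_line {u, v}" using eq by (simp add: insert_commute)
  note 4 = blue_leaf[OF V(4,3,1,2) ne(2)[symmetric] ne(1) eq'' u(2)[symmetric] u(4)[symmetric]]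
  show l: "u \<in> leaves" "v \<in> leaves" "u' \<in> leaves" "v' \<in> leaves" using 1 2 3 4 by auto
  define x y x' y' where xy: "x = nb u" "y = nb v" "x' = nb u'" "y' = nb v'"
  have xV: "x \<in> V" "y \<in> V" "x' \<in> V" "y' \<in> V" unfolding xy using nb(1) l by blast+
  have inner: "btw (nb a) z (nb b)"
    if "a \<in> leaves" "b \<in> leaves" "a \<noteq> b" "z \<in> V" "btw a z b" "z \<noteq> a" "z \<noteq> b" for a b z
  proof -
    have ab: "a \<in> V" "b \<in> V" using that leaves_subset by auto
    note s = nb[OF that(1)] nb[OF that(2)]
    have "btw a (nb a) z" "btw b (nb b) z" "btw a (nb a) b"
      using s that ab by metis+
    moreover have "nb a \<noteq> b" using s that by metis
    then have "btw b (nb b) (nb a)" using s ab by metis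
    moreover have "d z b = d b z" "d (nb b) z = d z (nb b)" "d (nb b) (nb a) = d (nb a) (nb b)"
      "d b (nb a) = d (nb a) b"
      using d_sym s ab that by blast+
    ultimately show ?thesis using that(5) s(2,7) by linarith
  qed
  have i: "btw x' x y'" "btw x' y y'" "btw x x' y" "btw x y' y"
    unfolding xy using inner[OF l(3,4) ne(2)] inner[OF l(1,2) ne(1)] 1 2 3 4 xV[unfolded xy] by blast+
  have sy: "d x y = d y x" "d x x' = d x' x" "d x y' = d y' x" "d y x' = d x' y" "d y y' = d y' y"
    using xV d_sym by blast+
  have "btw x' x y \<or> btw y' x y" using d_between[of x' y' x y] xV i by blast
  then show "{nb u, nb v} = {nb u', nb v'}"
  proof
    assume "btw x' x y"
    then have "d x x' = 0" "d y y' = 0" using i sy by linarith+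
    then show ?thesis using xV d_0 unfolding xy by simp
  next
    assume "btw y' x y"
    then have "d x y' = 0" "d y x' = 0" using i sy by linarith+
    then show ?thesis using xV d_0 unfolding xy by auto
  qed
qed

section \<open>The number of blue lines\<close>

definition supports :: "'a set" where "supports = nb ` leaves"
definition twin_supports :: "'a set" where "twin_supports = {x. \<exists>u \<in> leaves. \<exists>v \<in> leaves. u \<noteq> v \<and> nb u = x \<and> nb v = x}"
text \<open>One chosen leaf for each support; \<open>sec\<close> adds a second one where a support
  carries two. Elsewhere both choices are arbitrary.\<close>

definition rep :: "'a \<Rightarrow> 'a" where "rep x = (SOME u. u \<in> leaves \<and> nb u = x)"
definition sec :: "'a \<Rightarrow> 'a" where "sec x = (SOME u. u \<in> leaves \<and> nb u = x \<and> u \<noteq> rep x)"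

text \<open>
  One pair from each class of pairs that may generate the same blue line. An edge between a leaf and
  its neighbour is alone in its class; two leaves with a common neighbour form a class with all such
  pairs.
\<close>

definition reps :: "'a set set" where
  "reps = pairs (V - leaves \<union> rep ` supports) \<union> (\<lambda>u. {nb u, u}) ` (leaves - rep ` supports) \<union> (\<lambda>x. {rep x, sec x}) ` twin_supports"

lemma rep: assumes "x \<in> supports" shows "rep x \<in> leaves" "nb (rep x) = x"
proof -
  have "\<exists>u. u \<in> leaves \<and> nb u = x" using assms by (auto simp: supports_def)
  then have "rep x \<in> leaves \<and> nb (rep x) = x" unfolding rep_def by (rule someI_ex)
  then show "rep x \<in> leaves" "nb (rep x) = x" by auto
qed

lemma sec: assumes "x \<in> twin_supports" shows "sec x \<in> leaves" "nb (sec x) = x" "sec x \<noteq> rep x" "x \<in> supports"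
proof -
  have "\<exists>u. u \<in> leaves \<and> nb u = x \<and> u \<noteq> rep x" using assms unfolding twin_supports_def mem_Collect_eq by metis
  then have "sec x \<in> leaves \<and> nb (sec x) = x \<and> sec x \<noteq> rep x" unfolding sec_def by (rule someI_ex)
  then show "sec x \<in> leaves" "nb (sec x) = x" "sec x \<noteq> rep x" "x \<in> supports"
    unfolding supports_def by (metis, metis, metis, metis imageI)
qed

lemma rep_iff: "u \<in> leaves \<Longrightarrow> u \<in> rep ` supports \<longleftrightarrow> u = rep (nb u)"
  using rep by (auto simp: supports_def)

lemma sec_not_rep: "x \<in> twin_supports \<Longrightarrow> sec x \<notin> rep ` supports"
  using sec rep_iff by metis

text \<open>A leaf that was not chosen occurs in two kinds of pairs only: with its neighbour, which
  the last assumption excludes, and as the second leaf of a twin pair.\<close>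

lemma reps_nonrep:
  assumes "{u, v} \<in> reps" "u \<in> leaves" "u \<noteq> rep (nb u)" "v \<noteq> nb u"
  shows "v = rep (nb u)" "u = sec (nb u)"
proof -
  have u: "u \<notin> rep ` supports" using assms rep_iff by blast
  have "{u, v} \<notin> pairs (V - leaves \<union> rep ` supports)" using u assms by auto
  moreover have "{u, v} \<noteq> {nb w, w}" if "w \<in> leaves" for w
    using that nb(5) assms by (auto simp: doubleton_eq_iff)
  ultimately obtain x where "x \<in> twin_supports" "{u, v} = {rep x, sec x}" using assms(1) unfolding reps_def by blast
  then show "v = rep (nb u)" "u = sec (nb u)"
    using assms sec[of x] rep[of x] by (auto simp: doubleton_eq_iff)
qed

text \<open>At most one of the twins \<open>u\<close>, \<open>u'\<close> is \<open>rep x\<close>,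
  and one that is not is \<open>sec x\<close> with partner \<open>rep x\<close>. So
  \<open>u = u'\<close>, or one is the partner of the other, and the assumptions exclude
  both.\<close>

lemma reps_twins:
  assumes "{u, v} \<in> reps" "{u', v'} \<in> reps" "u \<in> leaves" "u' \<in> leaves" "nb u = nb u'" "u \<noteq> u'"
    "u \<noteq> v'" "u' \<noteq> v" "v \<noteq> nb u" "v' \<noteq> nb u"
  shows False
proof -
  define x where "x = nb u"
  have x: "nb u = x" "nb u' = x" using assms(5) by (auto simp: x_def)
  note 1 = reps_nonrep[OF assms(1,3), unfolded x] and 2 = reps_nonrep[OF assms(2,4), unfolded x]
  have "u \<noteq> rep x \<Longrightarrow> v = rep x \<and> u = sec x" using 1 assms(9) x by auto
  moreover have "u' \<noteq> rep x \<Longrightarrow> v' = rep x \<and> u' = sec x" using 2 assms(10) x by auto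
  ultimately show False using assms(6-8) by (cases "u = rep x"; cases "u' = rep x") auto
qed

lemma reps_subset: "reps \<subseteq> pairs V"
proof -
  have "pairs (V - leaves \<union> rep ` supports) \<subseteq> pairs V" using rep leaves_subset by (intro pairs_mono) auto
  moreover have "(\<lambda>u. {nb u, u}) ` (leaves - rep ` supports) \<subseteq> pairs V" 
    using nb(1,5) leaves_subset by (intro image_subsetI) (metis DiffD1 pairs_doubleton subsetD)
  moreover have "(\<lambda>x. {rep x, sec x}) ` twin_supports \<subseteq> pairs V" 
    using sec(1,3,4) rep(1) leaves_subset by (intro image_subsetI) (metis pairs_doubleton subsetD)
  ultimately show ?thesis unfolding reps_def by blast
qed

lemma repsE:
  assumes "e \<in> reps"
  obtains u v where "e = {u, v}" "u \<noteq> v" "u \<in> V" "v \<in> V"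
proof -
  have "e \<in> pairs V" using assms reps_subset by (rule rev_subsetD)
  then show thesis unfolding pairs_iff using that by blast
qed

text \<open>Distinct pairs are disjoint or share one vertex. In both cases equality of the blue
  lines produces twin leaves, to which \<open>reps_twins\<close> applies.\<close>

lemma inj_on_blue_line_reps: "inj_on blue_line reps"
proof (rule inj_onI, rule ccontr)
  fix e e' assume e: "e \<in> reps" "e' \<in> reps" "blue_line e = blue_line e'" "e \<noteq> e'"
  show False
  proof (cases "e \<inter> e' = {}")
    case True
    obtain u v where uv: "e = {u, v}" "u \<noteq> v" "u \<in> V" "v \<in> V"
      using e(1) by (rule repsE)
    obtain u' v' where uv': "e' = {u', v'}" "u' \<noteq> v'" "u' \<in> V" "v' \<in> V"
      using e(2) by (rule repsE)
    have ne: "u \<noteq> u'" "u \<noteq> v'" "v \<noteq> u'" "v \<noteq> v'" using True uv uv' by auto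
    have eq: "blue_line {u, v} = blue_line {u', v'}" using e uv uv' by simp
    note l = blue_eq_disjoint[OF uv(3,4) uv'(3,4) uv(2) uv'(2) eq ne]
    have nl: "v \<noteq> nb u" "v' \<noteq> nb u" "u' \<noteq> nb u" using l nb(5) by blast+
    have "nb u = nb u' \<or> nb u = nb v'" using l(5) by auto
    moreover have "{v', u'} \<in> reps" using e uv' by (simp add: insert_commute)
    ultimately show False
      using reps_twins[of u v u' v'] reps_twins[of u v v' u'] e uv uv' ne nl l by auto
  next
    case False
    then obtain v where v: "v \<in> e" "v \<in> e'" by auto
    obtain u where u: "e = {u, v}" "u \<noteq> v" "u \<in> V" "v \<in> V"
      using e(1) v by (metis repsE insert_commute insertE singletonD)
    obtain u' where u': "e' = {u', v}" "u' \<noteq> v" "u' \<in> V"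
      using e(2) v by (metis repsE insert_commute insertE singletonD)
    have "u \<noteq> u'" using e u u' by auto
    have "blue_line {u, v} = blue_line {u', v}" using e u u' by simp
    note l = blue_eq_meet[OF u(3,4) u'(3) u(2) u'(2) \<open>u \<noteq> u'\<close> this]
    show False using reps_twins[of u v u' v] e u u' l \<open>u \<noteq> u'\<close> by auto
  qed
qed

lemma card_reps: "card reps = ((card V - card leaves + card supports) choose 2) + (card leaves - card supports) + card twin_supports"
proof -
  have fS: "finite supports" unfolding supports_def using finite_leaves by simp
  have fS2: "finite twin_supports" using finite_subset[OF _ fS] sec(4) by (metis subsetI)
  \<comment> \<open>The inner vertices and one leaf for each support, hence the size
    \<open>card V - card leaves + card supports\<close>.\<close>
  let ?W = "V - leaves \<union> rep ` supports"
  have ir: "inj_on rep supports" using rep(2) by (metis inj_onI)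
  have rS: "rep ` supports \<subseteq> leaves" using rep by auto
  have cr: "card (rep ` supports) = card supports" using ir card_image by blast
  have "card ?W = card (V - leaves) + card (rep ` supports)"
    using rS fS fin by (intro card_Un_disjoint) auto
  then have W: "card ?W = card V - card leaves + card supports"
    using cr leaves_subset finite_leaves by (simp add: card_Diff_subset)
  have fW: "finite ?W" using fin fS by simp
  have c2: "card ((\<lambda>u. {nb u, u}) ` (leaves - rep ` supports)) = card leaves - card supports"
  proof -
    have "inj_on (\<lambda>u. {nb u, u}) (leaves - rep ` supports)"
      using nb(5) by (force simp: inj_on_def doubleton_eq_iff)
    then show ?thesis using cr rS fS by (simp add: card_image card_Diff_subset)
  qed
  have c3: "card ((\<lambda>x. {rep x, sec x}) ` twin_supports) = card twin_supports"
  proof -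
    have "inj_on (\<lambda>x. {rep x, sec x}) twin_supports"
      by (rule inj_onI) (metis doubleton_eq_iff sec(2,4) rep(2))
    then show ?thesis by (simp add: card_image)
  qed
  have d12: "pairs ?W \<inter> (\<lambda>u. {nb u, u}) ` (leaves - rep ` supports) = {}" by auto
  have d13: "(pairs ?W \<union> (\<lambda>u. {nb u, u}) ` (leaves - rep ` supports)) \<inter> (\<lambda>x. {rep x, sec x}) ` twin_supports = {}"
  proof -
    have "{rep x, sec x} \<notin> pairs ?W" if "x \<in> twin_supports" for x
      using sec_not_rep sec that by auto
    moreover have "{rep x, sec x} \<noteq> {nb u, u}" if "x \<in> twin_supports" "u \<in> leaves" for x u
      using sec rep nb(5) that by (metis doubleton_eq_iff)
    ultimately show ?thesis by blast
  qed
  show ?thesis unfolding reps_def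
    using d12 d13 W c2 c3 fW fS2 finite_leaves
    by (simp add: card_Un_disjoint finite_pairs card_pairs)
qed

lemma blue_lower:
  "card (blue_line ` pairs V) \<ge> ((card V - card leaves + card supports) choose 2) + (card leaves - card supports) + card twin_supports"
proof -
  have "card (blue_line ` reps) = card reps" using inj_on_blue_line_reps card_image by blast
  moreover have "card (blue_line ` reps) \<le> card (blue_line ` pairs V)"
    using reps_subset fin finite_pairs by (intro card_mono) auto
  ultimately show ?thesis using card_reps by simp
qed

end

section \<open>Leaves, paths and brooms\<close>

lemma downward_closed_initial:
  fixes I :: "nat set"
  assumes "finite I" "\<And>k. Suc k \<in> I \<Longrightarrow> k \<in> I"
  shows "I = {..<card I}"
proof (cases "I = {}")
  case False
  have down: "k \<in> I" if "m \<in> I" "k \<le> m" for k m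
    using that(2,1) by (induction rule: inc_induct) (auto intro: assms(2))
  have "I = {..Max I}"
    using down[OF Max_in[OF assms(1) False]] assms(1) by auto
  then have "card I = Suc (Max I)" by (metis card_atMost)
  then show ?thesis using \<open>I = {..Max I}\<close> lessThan_Suc_atMost by metis
qed simp

lemma path_graph_edge_iff:
  "i < n \<Longrightarrow> j < n \<Longrightarrow> {i, j} \<in> edges (path_graph n) \<longleftrightarrow> i = Suc j \<or> j = Suc i"
  by (auto simp: path_graph_def doubleton_eq_iff)

lemma S_tree_edge_iff:
  "i < q + p \<Longrightarrow> j < q + p \<Longrightarrow> {i, j} \<in> edges (S_tree p q) \<longleftrightarrow>
    i < q \<and> j < q \<and> (i = Suc j \<or> j = Suc i) \<or> i = 0 \<and> q \<le> j \<or> j = 0 \<and> q \<le> i"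
  by (auto simp: S_tree_def doubleton_eq_iff)

context tree_metric
begin

text \<open>A vertex at maximal distance from \<open>r\<close> beyond \<open>y\<close> is a leaf.\<close>

lemma leaf_beyond:
  assumes "r \<in> V" "y \<in> V"
  obtains u where "u \<in> leaves" "u \<noteq> r" "btw r y u"
proof -
  define A where "A = {u \<in> V. u \<noteq> r \<and> btw r y u}"
  have "\<exists>u. u \<in> A"
  proof (cases "y = r")
    case True
    then show ?thesis using other[of r r] assms d_refl[of r] by (auto simp: A_def)
  next
    case False
    then show ?thesis using assms d_refl[of y] by (auto simp: A_def)
  qed
  then have "A \<noteq> {}" by blast
  have fA: "finite A" using fin by (auto simp: A_def)
  then have "Max (d r ` A) \<in> d r ` A" using \<open>A \<noteq> {}\<close> by (intro Max_in) auto
  then obtain u where u: "u \<in> A" "d r u = Max (d r ` A)" by force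
  have max: "d r v \<le> d r u" if "v \<in> A" for v using u(2) fA that by simp
  have uV: "u \<in> V" "u \<noteq> r" "btw r y u" using u(1) unfolding A_def by blast+
  have False if ab: "a \<in> V" "b \<in> V" "btw a u b" "a \<noteq> u" "b \<noteq> u" for a b
  proof -
    have "btw a u r \<or> btw b u r" using d_between[of a b u r] ab uV assms by blast
    then obtain p where p: "p \<in> V" "p \<noteq> u" "btw r u p"
      using ab btw_sym uV assms by metis
    have "d u p \<noteq> 0" using p uV d_0 by metis
    then have "d r p > d r u" using p by linarith
    moreover have "btw r y p" using btw_trans(1)[OF assms uV(1) p(1) uV(3) p(3)] .
    moreover have "p \<noteq> r" using \<open>d r p > d r u\<close> d_refl assms by force
    ultimately show False using max[of p] p unfolding A_def by auto
  qed
  then have "u \<in> leaves" unfolding leaves_def leaf_def using uV by blast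
  then show thesis using that uV by blast
qed

lemma V_nonempty: "V \<noteq> {}"
  using card_V by auto

lemma leaves_through:
  assumes "y \<in> V"
  obtains u v where "u \<in> leaves" "v \<in> leaves" "u \<noteq> v" "btw u y v"
proof -
  obtain u where "u \<in> leaves" using leaf_beyond[OF assms assms] by blast
  moreover then have "u \<in> V" using leaves_subset by blast
  then obtain v where "v \<in> leaves" "v \<noteq> u" "btw u y v" using leaf_beyond assms by blast
  ultimately show thesis using that by blast
qed

lemma card_leaves: "card leaves \<ge> 2"
proof -
  obtain y where "y \<in> V" using V_nonempty by blast
  then obtain u v where uv: "u \<in> leaves" "v \<in> leaves" "u \<noteq> v" using leaves_through by blast
  have "card {u, v} \<le> card leaves" using uv finite_leaves by (intro card_mono) auto
  then show ?thesis using uv by simp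
qed

section \<open>Red lines of pairs of leaves\<close>

lemma V_red: "V \<in> red_line ` pairs V"
proof -
  obtain u where u: "u \<in> V" using V_nonempty by blast
  obtain p where p: "p \<in> V" "p \<noteq> u" using other u by blast
  then obtain z where z: "z \<in> V" "d u z = 1" using d_step[of u p] u by auto
  then have "red_line {u, z} = V" "u \<noteq> z" using red_line_edge u d_refl by auto
  then show ?thesis using u z by (metis image_eqI pairs_doubleton)
qed

text \<open>A leaf is never strictly between two vertices, so no third leaf is collinear with two
  given ones. Hence a pair of leaves can be read off its red line.\<close>

lemma red_line_leaves:
  assumes "e \<in> pairs leaves"
  shows "red_line e \<inter> leaves = e"
proof -
  obtain u v where e: "e = {u, v}" "u \<noteq> v" "u \<in> leaves" "v \<in> leaves" using assms unfolding pairs_iff by blast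
  have V: "u \<in> V" "v \<in> V" using e leaves_subset by auto
  have "p = u \<or> p = v" if "p \<in> leaves" "col u v p" for p
    using leavesD[of v u p] leavesD[of u v p] leavesD[of p u v] that e V leaves_subset by blast
  moreover have "col u v u" "col u v v" using d_refl V by auto
  ultimately show ?thesis unfolding e(1) red_line_doubleton[OF V] using V e by blast
qed

text \<open>The line \<open>V\<close>, generated by an edge, comes in addition: with three leaves,
  no red line of two leaves contains them all.\<close>

lemma red_lower:
  assumes "card leaves \<ge> 3"
  shows "card (red_line ` pairs V) \<ge> 1 + (card leaves choose 2)"
proof -
  have "inj_on red_line (pairs leaves)" using red_line_leaves by (metis inj_onI)
  then have c: "card (red_line ` pairs leaves) = card leaves choose 2" using finite_leaves by (simp add: card_image card_pairs)
  have "V \<noteq> red_line e" if "e \<in> pairs leaves" for e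
  proof
    assume "V = red_line e"
    then have "e = leaves" using red_line_leaves[OF that] leaves_subset by blast
    then show False using that assms by (auto simp: pairs_def)
  qed
  then have "card (insert V (red_line ` pairs leaves)) = 1 + (card leaves choose 2)"
    using c finite_leaves by (subst card_insert_disjoint) (auto simp: finite_pairs)
  moreover have "insert V (red_line ` pairs leaves) \<subseteq> red_line ` pairs V"
    using V_red pairs_mono[OF leaves_subset] by blast
  ultimately show ?thesis using card_mono[OF finite_imageI[OF finite_pairs[OF fin]]] by metis
qed

section \<open>Geodesics, and trees with two leaves or one support\<close>

lemma not_leaf:
  assumes "u \<in> V" "x \<in> V" "y \<in> V" "d u x = 1" "d u y = 1" "x \<noteq> y"
  shows "u \<notin> leaves"
  using two_neighbours[OF assms] leavesD[of u x y] assms d_refl by force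

text \<open>The distance from \<open>a\<close> determines the position on a geodesic, and stepping
  back towards \<open>a\<close> shows that no value is skipped. This numbering yields the
  isomorphisms with paths and with the handles of brooms.\<close>

lemma geodesic_index:
  assumes ab: "a \<in> V" "b \<in> V"
  defines "A \<equiv> {y \<in> V. btw a y b}"
  shows "bij_betw (d a) A {..<card A}"
    "\<And>x y. x \<in> A \<Longrightarrow> y \<in> A \<Longrightarrow> d x y = 1 \<longleftrightarrow> d a x = Suc (d a y) \<or> d a y = Suc (d a x)"
proof -
  have gd: "d a y = d a x + d x y \<or> d a x = d a y + d x y" if "x \<in> A" "y \<in> A" for x y
    using geodesic_btw[of x y a b] d_sym[of x y] that ab unfolding A_def mem_Collect_eq by metis
  then show "d x y = 1 \<longleftrightarrow> d a x = Suc (d a y) \<or> d a y = Suc (d a x)" if "x \<in> A" "y \<in> A" for x y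
    using gd[OF that] by linarith
  have inj: "inj_on (d a) A"
  proof (rule inj_onI)
    fix x y assume xy: "x \<in> A" "y \<in> A" "d a x = d a y"
    then have "d x y = 0" using gd[OF xy(1,2)] by linarith
    then show "x = y" using xy d_0 unfolding A_def by blast
  qed
  have fA: "finite A" using fin by (auto simp: A_def)
  have "k \<in> d a ` A" if Sk: "Suc k \<in> d a ` A" for k
  proof -
    obtain y where yA: "y \<in> A" "Suc k = d a y" using Sk by (auto simp only: image_iff)
    then have y: "y \<in> V" "btw a y b" "d a y = Suc k" unfolding A_def mem_Collect_eq by metis+
    then have "y \<noteq> a" using d_refl ab by (metis nat.distinct(1))
    then obtain z where z: "z \<in> V" "d y z = 1" "btw y z a" using d_step y ab by blast
    have "d a z = k" using z y d_sym ab by (metis add_left_cancel plus_1_eq_Suc)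
    moreover have "btw a z y" using z y ab btw_sym by blast
    then have "btw a z b" using btw_trans(1) ab z y by blast
    ultimately show ?thesis using z unfolding A_def by blast
  qed
  then have "d a ` A = {..<card (d a ` A)}" using fA by (intro downward_closed_initial) auto
  then show "bij_betw (d a) A {..<card A}" using inj card_image[OF inj] by (simp add: bij_betw_def)
qed

lemma two_leaves:
  assumes "card leaves = 2"
  obtains a b where "a \<in> V" "b \<in> V" "{y \<in> V. btw a y b} = V"
proof -
  obtain a b where leaves: "leaves = {a, b}" "a \<noteq> b" using assms unfolding card_2_iff by blast
  have ab: "a \<in> V" "b \<in> V" using leaves leaves_subset by auto
  have "btw a y b" if y: "y \<in> V" for y
  proof -
    obtain u where "u \<in> leaves" "u \<noteq> a" "btw a y u" by (rule leaf_beyond[OF ab(1) y])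
    then show ?thesis using leaves by blast
  qed
  then show thesis using that[OF ab] by blast
qed

text \<open>All vertices lie on one geodesic, so any three are collinear: each red line is
  \<open>V\<close> and each blue line is its generating pair.\<close>

lemma two_leaves_lines:
  assumes "card leaves = 2"
  shows "card (red_line ` pairs V) = 1" "card (blue_line ` pairs V) = card V choose 2"
proof -
  obtain a b where ab: "a \<in> V" "b \<in> V" "{y \<in> V. btw a y b} = V" by (rule two_leaves[OF assms])
  have RV: "red_line e = V" if e: "e \<in> pairs V" for e
  proof -
    obtain u v where e: "e = {u, v}" "u \<in> V" "v \<in> V" using e unfolding pairs_iff by blast
    have "col u v p" if "p \<in> V" for p
      using geodesic_col[of u v p a b] that e ab by blast
    then show ?thesis unfolding e(1) red_line_doubleton[OF e(2,3)] by blast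
  qed
  then have "red_line ` pairs V = {V}" using V_red by blast
  then show "card (red_line ` pairs V) = 1" by simp
  have "blue_line e = e" if "e \<in> pairs V" for e
    using RV[OF that] that by (auto simp: blue_line_def)
  then have "blue_line ` pairs V = pairs V" by simp
  then show "card (blue_line ` pairs V) = card V choose 2" using card_pairs fin by simp
qed

lemma path_iso_card_leaves:
  assumes h: "bij_betw h V {..<n}"
    and edge: "\<And>u v. u \<in> V \<Longrightarrow> v \<in> V \<Longrightarrow> d u v = 1 \<longleftrightarrow> {h u, h v} \<in> edges (path_graph n)"
  shows "card leaves = 2"
proof -
  have "h u = 0 \<or> h u = n - 1" if "u \<in> leaves" for u
  proof (rule ccontr)
    assume *: "\<not> (h u = 0 \<or> h u = n - 1)"
    have u: "u \<in> V" using that leaves_subset by blast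
    have lt: "h y < n" if "y \<in> V" for y using bij_betwE[OF h] that by auto
    have "h u - 1 \<in> h ` V" "Suc (h u) \<in> h ` V" using h * lt[OF u] by (auto simp: bij_betw_def)
    then obtain x y where xy: "x \<in> V" "y \<in> V" "h x = h u - 1" "h y = Suc (h u)" by auto
    have "d u x = 1" "d u y = 1" using edge xy u lt * path_graph_edge_iff by auto
    moreover have "x \<noteq> y" using xy(3,4) by (metis Suc_n_not_le_n diff_le_self)
    ultimately show False using not_leaf[of u x y] xy u that by blast
  qed
  then have "h ` leaves \<subseteq> {0, n - 1}" by (intro image_subsetI) simp
  then have "card (h ` leaves) \<le> card {0, n - 1}" by (intro card_mono) auto
  also have "\<dots> \<le> 2" by (simp add: card_insert_if)
  finally have "card (h ` leaves) \<le> 2" .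
  moreover have "card (h ` leaves) = card leaves"
    using h leaves_subset inj_on_subset by (intro card_image) (auto simp: bij_betw_def)
  ultimately show ?thesis using card_leaves by simp
qed

text \<open>All leaves hang at one vertex \<open>x\<close>, so any two are at distance two. An inner
  vertex lies between two leaves and must therefore be \<open>x\<close>: the tree is a star.\<close>

lemma one_support:
  assumes "card supports = 1"
  shows "card V = card leaves + 1"
proof -
  obtain x where x: "supports = {x}" using assms card_1_singletonE by blast
  have nbx: "nb u = x" if "u \<in> leaves" for u using x that by (auto simp: supports_def)
  obtain l where "l \<in> leaves" using card_leaves by fastforce
  then have xV: "x \<in> V" "x \<notin> leaves" using nb nbx by metis+
  have "y = x" if y: "y \<in> V" "y \<notin> leaves" for y
  proof -
    obtain u v where uv: "u \<in> leaves" "v \<in> leaves" "u \<noteq> v" "btw u y v" by (rule leaves_through[OF y(1)])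
    have V: "u \<in> V" "v \<in> V" using uv leaves_subset by auto
    have "btw u x y" "btw v x y" "btw u x v" "d u x = 1" "d v x = 1"
      using nb(2)[of u] nb(2)[of v] nb(4)[of u y] nb(4)[of v y] nb(4)[of u v] nbx uv V y by auto
    moreover have "d y v = d v y" "d x v = d v x" using V y xV d_sym by blast+
    ultimately have "d x y = 0" using uv by linarith
    then show ?thesis using d_0 xV y by blast
  qed
  then have "V = insert x leaves" using xV leaves_subset by blast
  then show ?thesis using finite_leaves xV(2) by (metis Suc_eq_plus1 card_insert_disjoint)
qed

text \<open>The trees \<open>S(p, q)\<close>: \<open>p = card P\<close> leaves at \<open>c\<close>, and a handle running from \<open>c\<close> to the leaf \<open>z\<close>.\<close>

definition broom :: "'a \<Rightarrow> 'a \<Rightarrow> 'a set \<Rightarrow> bool" where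
  "broom c z P \<longleftrightarrow> leaves = insert z P \<and> z \<notin> P \<and> (\<forall>u \<in> P. nb u = c) \<and> card P \<ge> 2"

text \<open>Of the two supports only \<open>x\<close> carries several leaves, so the leaf at
  \<open>y\<close> is unique and serves as the end of the handle.\<close>

lemma broomI:
  assumes "card supports = 2" "card twin_supports = 1" "card leaves \<ge> 3"
  obtains c z P where "broom c z P"
proof -
  obtain x where x: "twin_supports = {x}" using assms card_1_singletonE by blast
  have xS: "x \<in> supports" using x sec(4) by blast
  obtain a b where "supports = {a, b}" "a \<noteq> b" using assms(1) unfolding card_2_iff by blast
  then obtain y where y: "supports = {x, y}" "y \<noteq> x" using xS by (cases "x = a") auto
  define P where "P = {u \<in> leaves. nb u = x}"
  have "rep y \<in> leaves" "nb (rep y) = y" using rep y by auto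
  have "leaves = insert (rep y) P"
  proof -
    have "u = rep y" if "u \<in> leaves" "nb u \<noteq> x" for u
    proof (rule ccontr)
      assume "u \<noteq> rep y"
      moreover have "nb u = y" using that y by (auto simp: supports_def)
      ultimately have "y \<in> twin_supports" using that \<open>rep y \<in> leaves\<close> \<open>nb (rep y) = y\<close> unfolding twin_supports_def by blast
      then show False using x y by simp
    qed
    then show ?thesis using \<open>rep y \<in> leaves\<close> by (auto simp: P_def)
  qed
  moreover have "rep y \<notin> P" using y \<open>nb (rep y) = y\<close> by (auto simp: P_def)
  moreover have "finite P" using finite_leaves by (auto simp: P_def)
  moreover from calculation have "card leaves = Suc (card P)" by (metis card_insert_disjoint)
  moreover have "\<forall>u \<in> P. nb u = x" by (simp add: P_def)
  ultimately have "broom x (rep y) P" using assms(3) unfolding broom_def by linarith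
  then show thesis using that by blast
qed

section \<open>The lines of a broom\<close>

lemma broom_simps:
  assumes broom: "broom c z P"
  shows "leaves = insert z P" "z \<notin> P" "card P \<ge> 2" "c \<in> V" "c \<notin> leaves" "z \<in> V" "P \<subseteq> V" "finite P"
  "u \<in> P \<Longrightarrow> u \<in> leaves" "u \<in> P \<Longrightarrow> d u c = 1"
  "u \<in> P \<Longrightarrow> y \<in> V \<Longrightarrow> y \<noteq> u \<Longrightarrow> btw u c y"
proof -
  have P: "nb u = c" if "u \<in> P" for u using broom that by (auto simp: broom_def)
  show leaves: "leaves = insert z P" and "z \<notin> P" and "card P \<ge> 2" using broom by (auto simp: broom_def)
  then have "P \<noteq> {}" by (metis card.empty not_numeral_le_zero)
  then obtain u where u: "u \<in> P" by blast
  have PL: "v \<in> leaves" if "v \<in> P" for v unfolding leaves using that by (rule insertI2)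
  show "c \<in> V" "c \<notin> leaves" using nb(1,5)[OF PL[OF u]] unfolding P[OF u] by blast+
  show "z \<in> V" "P \<subseteq> V" "finite P" using leaves leaves_subset finite_leaves by auto
  show "u \<in> P \<Longrightarrow> u \<in> leaves" "u \<in> P \<Longrightarrow> d u c = 1" "u \<in> P \<Longrightarrow> y \<in> V \<Longrightarrow> y \<noteq> u \<Longrightarrow> btw u c y" for u y
    using nb(2,4)[OF PL, of u] P[of u] PL[of u] by metis+
qed

text \<open>Seen from \<open>z\<close>, some leaf beyond \<open>y\<close> is in \<open>P\<close>,
  and its path to \<open>z\<close> enters the handle through \<open>c\<close>. Conversely, a leaf in
  \<open>P\<close> is not between \<open>c\<close> and \<open>z\<close>.\<close>

lemma broom_handle:
  assumes broom: "broom c z P"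
  shows "V - P = {y \<in> V. btw c y z}"
proof -
  note broom_simps = broom_simps[OF broom]
  have "btw c y z" if y: "y \<in> V" "y \<notin> P" for y
  proof -
    obtain v where v: "v \<in> leaves" "v \<noteq> z" "btw z y v" by (rule leaf_beyond[OF broom_simps(6) y(1)])
    have vP: "v \<in> P" "v \<in> V" "y \<noteq> v" using v broom_simps y by auto
    have "btw v c y" "btw v c z" using broom_simps vP v y by metis+
    moreover have "d v z = d z v" "d y v = d v y" "d z y = d y z" using d_sym vP y broom_simps by blast+
    ultimately show ?thesis using v by linarith
  qed
  moreover have "y \<notin> P" if "y \<in> V" "btw c y z" for y
    using leavesD[of y c z] that broom_simps by blast
  ultimately show ?thesis by blast
qed

text \<open>The geodesic from a bristle \<open>p\<close>, that is a leaf in \<open>P\<close>, to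
  \<open>z\<close> contains the whole handle. So three vertices with at most one bristle among them
  are collinear.\<close>

lemma red_line_handle:
  assumes broom: "broom c z P" and uv: "u \<in> V - P" "v \<in> V - P"
  shows "red_line {u, v} = V"
proof -
  note broom_simps = broom_simps[OF broom]
    and broom_handle = broom_handle[OF broom]
  have "col u v p" if p: "p \<in> V" for p
  proof (cases "p \<in> P")
    case False
    then show ?thesis using geodesic_col[of u v p c z] uv p broom_handle broom_simps by blast
  next
    case True
    have "btw p c z" "btw p c u" "btw p c v" using broom_simps True uv by blast+
    moreover have "btw c u z" "btw c v z" using uv broom_handle by blast+
    ultimately have "btw p u z" "btw p v z" by linarith+
    moreover have "btw p p z" using p d_refl by simp
    ultimately show ?thesis using geodesic_col[of u v p p z] uv p broom_simps by blast
  qed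
  then show ?thesis using uv red_line_doubleton[of u v] by blast
qed

text \<open>The geodesic from \<open>u\<close> to \<open>z\<close> contains the handle, while the
  other bristles branch off at \<open>c\<close>, strictly before \<open>v\<close>.\<close>

lemma red_line_bristle:
  assumes broom: "broom c z P" and assms: "u \<in> P" "v \<in> V - P" "v \<noteq> c"
  shows "red_line {u, v} = insert u (V - P)"
proof -
  note broom_simps = broom_simps[OF broom]
    and broom_handle = broom_handle[OF broom]
  have V: "u \<in> V" "v \<in> V" "u \<noteq> v" using assms broom_simps by blast+
  have "col u v p" if p: "p \<in> V - P" for p
  proof -
    have "btw u c z" "btw u c p" "btw u c v" using broom_simps assms p by blast+
    moreover have "btw c p z" "btw c v z" using assms p broom_handle by blast+
    ultimately have "btw u p z" "btw u v z" by linarith+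
    moreover have "btw u u z" using V d_refl by simp
    ultimately show ?thesis using geodesic_col[of u v p u z] V p broom_simps by blast
  qed
  moreover have "col u v u" using V d_refl by simp
  moreover have "\<not> col u v p" if p: "p \<in> P" "p \<noteq> u" for p
  proof
    have pV: "p \<in> V" "p \<noteq> v" using p assms broom_simps by blast+
    assume "col u v p"
    then have "btw u v p" using leavesD[of u v p] leavesD[of p u v] V pV p assms broom_simps(9) by blast
    moreover have "btw u c p" "btw u c v" "btw p c v" "d p c = 1" "d u c = 1"
      using broom_simps(10,11) p pV assms V by metis+
    moreover have "d c p = d p c" "d v p = d p v" "d c v \<noteq> 0"
      using d_sym d_0 pV V broom_simps assms by metis+
    ultimately show False by linarith
  qed
  ultimately show ?thesis unfolding red_line_doubleton[OF V(1,2)] using V by blast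
qed

lemma red_line_bristles:
  assumes broom: "broom c z P" and assms: "u \<in> P" "v \<in> P" "u \<noteq> v"
  shows "red_line {u, v} = {u, v, c}"
proof -
  note broom_simps = broom_simps[OF broom]
  have V: "u \<in> V" "v \<in> V" using assms broom_simps by blast+
  have "p = u \<or> p = v \<or> p = c" if p: "p \<in> V" "col u v p" for p
  proof (rule ccontr)
    assume *: "\<not> (p = u \<or> p = v \<or> p = c)"
    then have "btw u p v" using leavesD[of u v p] leavesD[of v u p] V p assms broom_simps(9) by blast
    moreover have "btw u c p" "btw u c v" "btw v c p" using broom_simps(11) assms * p V by metis+
    moreover have "d p v = d v p" "d c v = d v c" "d c p \<noteq> 0"
      using d_sym d_0 p V broom_simps * by metis+
    ultimately show False by linarith
  qed
  moreover have "col u v u" "col u v v" using V d_refl by simp_all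
  moreover have "col u v c" using broom_simps(11) assms V by metis
  ultimately show ?thesis unfolding red_line_doubleton[OF V] using V broom_simps(4) by blast
qed

lemma broom_pair_cases:
  assumes "e \<in> pairs V"
  obtains u v where "e = {u, v}" "u \<in> V - P" "v \<in> V - P" "u \<noteq> v"
  | u where "e = {u, c}" "u \<in> P"
  | u v where "e = {u, v}" "u \<in> P" "v \<in> V - P" "v \<noteq> c"
  | u v where "e = {u, v}" "u \<in> P" "v \<in> P" "u \<noteq> v"
  using assms unfolding pairs_iff by (metis DiffI insert_commute)

text \<open>A bristle generates the same red line with any handle vertex other than \<open>c\<close>
  as with \<open>z\<close>, so apart from \<open>V\<close> only pairs of leaves yield red
  lines.\<close>

lemma broom_upper:
  assumes broom: "broom c z P"
  shows "card (red_line ` pairs V) \<le> 1 + (card leaves choose 2)"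
  "card (blue_line ` pairs V) \<le> 1 + (card (V - P) - 1) + card P + (card (V - P) choose 2)"
proof -
  note broom_simps = broom_simps[OF broom]
    and red_line_handle = red_line_handle[OF broom]
    and red_line_bristle = red_line_bristle[OF broom]
    and red_line_bristles = red_line_bristles[OF broom]
    and pair_cases = broom_pair_cases[where P = P and c = c]
  have RL: "red_line e \<in> insert V (red_line ` pairs leaves)" if "e \<in> pairs V" for e
    using that
  proof (cases rule: pair_cases)
    case (1 u v)
    then show ?thesis using red_line_handle by blast
  next
    case (2 u)
    then show ?thesis using red_line_edge[of u c] broom_simps by blast
  next
    case (3 u v)
    have "z \<in> V - P" "z \<noteq> c" using broom_simps by blast+
    then have "red_line e = red_line {u, z}" using 3 red_line_bristle by metis
    moreover have "{u, z} \<in> pairs leaves" using 3 broom_simps by auto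
    ultimately show ?thesis by blast
  next
    case (4 u v)
    then have "e \<in> pairs leaves" using broom_simps by auto
    then show ?thesis by blast
  qed
  have "card (red_line ` pairs V) \<le> card (insert V (red_line ` pairs leaves))"
    using RL finite_leaves by (intro card_mono) (auto simp: finite_pairs)
  also have "\<dots> \<le> Suc (card (red_line ` pairs leaves))"
    using finite_leaves by (simp add: card_insert_if finite_pairs)
  also have "card (red_line ` pairs leaves) \<le> card leaves choose 2"
    using finite_leaves card_image_le[of "pairs leaves" red_line] by (simp add: finite_pairs card_pairs)
  finally show "card (red_line ` pairs V) \<le> 1 + (card leaves choose 2)" by simp
  let ?U = "V - P"
  \<comment> \<open>Two bristles give the blue line \<open>V - {c}\<close>, and a bristle with a
    handle vertex \<open>v\<close> other than \<open>c\<close> gives \<open>insert v P\<close>,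
    whatever the bristle. A bristle with \<open>c\<close>, or two handle vertices, give just the
    pair.\<close>
  let ?X = "{V - {c}}" and ?Y = "(\<lambda>v. insert v P) ` (?U - {c})" and ?Z = "(\<lambda>u. {u, c}) ` P"
  have "blue_line e \<in> ?X \<union> ?Y \<union> ?Z \<union> pairs ?U" if "e \<in> pairs V" for e
    using that
  proof (cases rule: pair_cases)
    case (1 u v)
    then have "blue_line e = e" using red_line_handle unfolding blue_line_def by blast
    then show ?thesis using 1 by auto
  next
    case (2 u)
    then have "blue_line e = e" using red_line_edge[of u c] broom_simps unfolding blue_line_def by blast
    then show ?thesis using 2 by blast
  next
    case (3 u v)
    then have "blue_line e = insert v P" using red_line_bristle[of u v] broom_simps(7) unfolding blue_line_def by auto
    then show ?thesis using 3 by blast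
  next
    case (4 u v)
    then have "c \<notin> e" using broom_simps by blast
    then have "blue_line e = V - {c}" using 4 red_line_bristles[of u v] broom_simps(7) unfolding blue_line_def by auto
    then show ?thesis by blast
  qed
  then have "card (blue_line ` pairs V) \<le> card (?X \<union> ?Y \<union> ?Z \<union> pairs ?U)"
    using fin broom_simps(8) by (intro card_mono) (auto simp: finite_pairs)
  also have "\<dots> \<le> card ?X + card ?Y + card ?Z + card (pairs ?U)"
    by (meson add_mono card_Un_le le_trans order_refl)
  also have "\<dots> \<le> 1 + (card ?U - 1) + card P + (card ?U choose 2)"
  proof -
    have "card ?Y \<le> card ?U - 1"
      using card_image_le[of "?U - {c}" "\<lambda>v. insert v P"] fin broom_simps by auto
    moreover have "card ?Z \<le> card P" using card_image_le broom_simps(8) by blast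
    ultimately show ?thesis using fin by (simp add: card_pairs)
  qed
  finally show "card (blue_line ` pairs V) \<le> 1 + (card ?U - 1) + card P + (card ?U choose 2)" .
qed

text \<open>Handle vertices are numbered by their distance from \<open>c\<close>, so that
  \<open>c\<close> becomes 0; the bristles take the remaining numbers in any order.\<close>

lemma broom_iso:
  assumes broom: "broom c z P" and q: "q = card (V - P)" and p: "p = card P"
  obtains h where "bij_betw h V {..<q + p}"
    "\<And>u v. u \<in> V \<Longrightarrow> v \<in> V \<Longrightarrow> d u v = 1 \<longleftrightarrow> {h u, h v} \<in> edges (S_tree p q)"
proof -
  note broom_simps = broom_simps[OF broom]
    and broom_handle = broom_handle[OF broom]
  have "card P = card {q..<q + p}" using p by simp
  then obtain g where g: "bij_betw g P {q..<q + p}"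
    using finite_same_card_bij[OF broom_simps(8) finite_atLeastLessThan] by blast
  note gi = geodesic_index[OF broom_simps(4,6), folded broom_handle, folded q]
  define h where "h y = (if y \<in> P then g y else d c y)" for y
  have 1: "bij_betw h (V - P) {..<q}" using gi(1) by (rule bij_betw_cong[THEN iffD1, rotated]) (simp add: h_def)
  have 2: "bij_betw h P {q..<q + p}" using g by (rule bij_betw_cong[THEN iffD1, rotated]) (simp add: h_def)
  have bij: "bij_betw h ((V - P) \<union> P) ({..<q} \<union> {q..<q + p})"
    using 1 2 by (rule bij_betw_combine) auto
  moreover have "(V - P) \<union> P = V" "{..<q} \<union> {q..<q + p} = {..<q + p}" using broom_simps(7) by auto
  ultimately have hb: "bij_betw h V {..<q + p}" by simp
  have hP: "q \<le> h u \<and> h u < q + p" if "u \<in> P" for u using bij_betwE[OF 2] that by auto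
  have hU: "h u < q" if "u \<in> V - P" for u using bij_betwE[OF 1] that by auto
  have cU: "c \<in> V - P" using broom_simps by blast
  have h0: "h u = 0 \<longleftrightarrow> u = c" if "u \<in> V - P" for u
    using that d_0 broom_simps(4) by (auto simp: h_def)
  have attach: "d u v = 1 \<longleftrightarrow> v = c" if "u \<in> P" "v \<in> V" "u \<noteq> v" for u v
  proof -
    have "btw u c v" "d u c = 1" using broom_simps that by blast+
    then show ?thesis using d_0[of c v] broom_simps(4) that by auto
  qed
  have "d u v = 1 \<longleftrightarrow> {h u, h v} \<in> edges (S_tree p q)" if uv: "u \<in> V" "v \<in> V" for u v
  proof -
    have lt: "h u < q + p" "h v < q + p" using bij_betwE[OF hb] uv by auto
    consider "u \<in> V - P" "v \<in> V - P" | "u \<in> P" "v \<in> V - P" | "u \<in> V - P" "v \<in> P"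
      | "u \<in> P" "v \<in> P" "u \<noteq> v" | "u = v" "u \<in> P" using uv by blast
    then show ?thesis
    proof cases
      case 1
      have "d u v = 1 \<longleftrightarrow> h u = Suc (h v) \<or> h v = Suc (h u)" using gi(2)[of u v] 1 by (simp add: h_def)
      then show ?thesis unfolding S_tree_edge_iff[OF lt] using hU[OF 1(1)] hU[OF 1(2)] by auto
    next
      case 2
      then have "u \<noteq> v" by blast
      have "d u v = 1 \<longleftrightarrow> v = c" using attach[OF 2(1) uv(2) \<open>u \<noteq> v\<close>] .
      then show ?thesis unfolding S_tree_edge_iff[OF lt]
        using hP[OF 2(1)] hU[OF 2(2)] h0[OF 2(2)] by auto
    next
      case 3
      then have "v \<noteq> u" by blast
      have "d u v = 1 \<longleftrightarrow> u = c" using attach[OF 3(2) uv(1) \<open>v \<noteq> u\<close>] d_sym[of u v] uv by simp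
      then show ?thesis unfolding S_tree_edge_iff[OF lt]
        using hP[OF 3(2)] hU[OF 3(1)] h0[OF 3(1)] by auto
    next
      case 4
      have "v \<noteq> c" using 4 cU by blast
      then have "d u v \<noteq> 1" using attach 4 uv by blast
      then show ?thesis unfolding S_tree_edge_iff[OF lt]
        using hP[OF 4(1)] hP[OF 4(2)] hU[OF cU] by auto
    next
      case 5
      have "d u v \<noteq> 1" using 5 d_refl uv by simp
      then show ?thesis unfolding S_tree_edge_iff[OF lt]
        using hP[OF 5(2)] 5 hU[OF cU] by auto
    qed
  qed
  then show thesis using that hb by blast
qed

text \<open>The leaves of \<open>S_tree p q\<close> are the numbers from \<open>q - 1\<close> on;
  the first of them is the far end of the handle.\<close>

lemma S_tree_iso_broom:
  assumes pq: "p \<ge> 2" "q \<ge> 2"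
    and h: "bij_betw h V {..<q + p}"
    and edge: "\<And>u v. u \<in> V \<Longrightarrow> v \<in> V \<Longrightarrow> d u v = 1 \<longleftrightarrow> {h u, h v} \<in> edges (S_tree p q)"
  obtains c z P where "broom c z P" "card P = p" "card (V - P) = q"
proof -
  define k where "k = inv_into V h"
  have hk: "h (k i) = i" "k i \<in> V" if "i < q + p" for i
    using h that unfolding k_def
    by (auto simp: bij_betw_def f_inv_into_f inv_into_into)
  have kh: "k (h u) = u" if "u \<in> V" for u
    using h that unfolding k_def by (simp add: bij_betw_def)
  have lt: "h y < q + p" if "y \<in> V" for y using bij_betwE[OF h] that by auto
  have edge': "d u v = 1 \<longleftrightarrow> h u < q \<and> h v < q \<and> (h u = Suc (h v) \<or> h v = Suc (h u))
      \<or> h u = 0 \<and> q \<le> h v \<or> h v = 0 \<and> q \<le> h u" if "u \<in> V" "v \<in> V" for u v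
    unfolding edge[OF that] using S_tree_edge_iff lt that by blast
  define P where "P = {u \<in> V. q \<le> h u}"
  define z where "z = k (q - 1)"
  have z: "z \<in> V" "h z = q - 1" using hk[of "q - 1"] pq by (auto simp: z_def)
  have leafs: "u \<in> leaves" if u: "u \<in> V" and hu: "q - 1 \<le> h u" for u
  proof (rule leafI[OF u])
    fix x y assume xy: "x \<in> V" "y \<in> V" "d u x = 1" "d u y = 1"
    \<comment> \<open>The end \<open>q - 1\<close> of the path has the only neighbour
      \<open>q - 2\<close>, also for \<open>q = 2\<close>, where this is the attaching vertex
      0.\<close>
    have "h x = (if h u = q - 1 then q - 2 else 0)" if "x \<in> V" "d u x = 1" for x
      using that(2) edge'[OF u that(1)] hu pq by auto
    then have "h x = h y" using xy by metis
    then show "x = y" using kh xy by metis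
  qed
  have two: "u \<notin> leaves"
    if "u \<in> V" "i < q + p" "j < q + p" "i \<noteq> j" "d u (k i) = 1" "d u (k j) = 1" for u i j
    using not_leaf[of u "k i" "k j"] hk[OF that(2)] hk[OF that(3)] that(1,4-6) by metis
  have nl: "u \<notin> leaves" if u: "u \<in> V" and hu: "h u < q - 1" for u
  proof (cases "h u = 0")
    case True
    \<comment> \<open>Because \<open>p\<close> is at least 2, two of the additional leaves hang at
      the vertex 0.\<close>
    have i: "q < q + p" "Suc q < q + p" using pq by auto
    have "d u (k q) = 1" "d u (k (Suc q)) = 1"
      using edge'[OF u hk(2)[OF i(1)]] edge'[OF u hk(2)[OF i(2)]] hk(1)[OF i(1)] hk(1)[OF i(2)] True
      by simp_all
    then show ?thesis by (rule two[OF u i n_not_Suc_n])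
  next
    case False
    have i: "h u - 1 < q + p" "Suc (h u) < q + p" "h u - 1 \<noteq> Suc (h u)" using hu by auto
    have "h u < q" "h u - 1 < q" "Suc (h u) < q" "h u = Suc (h u - 1)" using hu False by auto
    then have "d u (k (h u - 1)) = 1" "d u (k (Suc (h u))) = 1"
      unfolding edge'[OF u hk(2)[OF i(1)]] edge'[OF u hk(2)[OF i(2)]] hk(1)[OF i(1)] hk(1)[OF i(2)]
      by blast+
    then show ?thesis by (rule two[OF u i])
  qed
  have leaves: "leaves = {u \<in> V. q - 1 \<le> h u}"
  proof
    show "leaves \<subseteq> {u \<in> V. q - 1 \<le> h u}" using nl leaves_subset not_le_imp_less by blast
    show "{u \<in> V. q - 1 \<le> h u} \<subseteq> leaves" using leafs by blast
  qed
  have "u = z \<longleftrightarrow> h u = q - 1" if "u \<in> V" for u using that kh z by metis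
  moreover have "q - 1 \<le> i \<longleftrightarrow> i = q - 1 \<or> q \<le> i" for i using pq by linarith
  ultimately have "leaves = insert z P" unfolding leaves P_def using z(1) by blast
  moreover have "z \<notin> P" using z pq by (auto simp: P_def)
  moreover have "nb u = k 0" if "u \<in> P" for u
  proof -
    have u: "u \<in> V" "q \<le> h u" using that by (simp_all add: P_def)
    have "u \<in> leaves" using leafs u by simp
    have k0: "h (k 0) = 0" "k 0 \<in> V" using hk[of 0] pq by simp_all
    then have "d u (k 0) = 1" using edge'[OF u(1) k0(2)] u by simp
    then show ?thesis using nb(3)[OF \<open>u \<in> leaves\<close> k0(2)] by simp
  qed
  moreover have cP: "card P = p"
  proof -
    have "bij_betw h P {q..<q + p}"
    proof (rule bij_betw_subset[OF h, of P "{q..<q + p}"])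
      show "h ` P = {q..<q + p}"
      proof
        show "h ` P \<subseteq> {q..<q + p}" using lt by (auto simp: P_def)
        show "{q..<q + p} \<subseteq> h ` P"
        proof
          fix i assume "i \<in> {q..<q + p}"
          then have "k i \<in> P" "h (k i) = i" using hk[of i] by (auto simp: P_def)
          then show "i \<in> h ` P" by (metis imageI)
        qed
      qed
    qed (auto simp: P_def)
    then show ?thesis using bij_betw_same_card by fastforce
  qed
  ultimately have "broom (k 0) z P" using pq unfolding broom_def by blast
  moreover have "card (V - P) = q"
  proof -
    have "card V = q + p" using bij_betw_same_card[OF h] by simp
    moreover have "P \<subseteq> V" "finite P" using fin by (auto simp: P_def)
    ultimately show ?thesis using cP by (simp add: card_Diff_subset)
  qed
  ultimately show thesis using that cP by blast
qed

end

section \<open>Minimizing over the size of the broom\<close>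

lemma choose_two_int: "2 * int (n choose 2) = int n * (int n - 1)"
proof (induction n)
  case (Suc n)
  have "Suc n choose 2 = n + (n choose 2)" by (simp add: numeral_2_eq_2)
  then show ?case using Suc by (simp add: algebra_simps)
qed simp

text \<open>The count for S(p, n - p), which has p + 1 leaves and two supports. The first two terms
  count red lines, the others blue ones; the last \<open>p\<close> consists of p - 1 unchosen leaves
  and one twin support.\<close>

definition broom_lines :: "nat \<Rightarrow> nat \<Rightarrow> nat" where
  "broom_lines n p = 1 + (p + 1 choose 2) + (n - p + 1 choose 2) + p"

definition min_lines :: "nat \<Rightarrow> nat" where
  "min_lines n = n * n div 4 + n + 1"

lemma floor_min_lines: "\<lfloor>(real n)\<^sup>2 / 4 + real n + 1\<rfloor> = int (min_lines n)"
proof -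
  have "\<lfloor>(real n)\<^sup>2 / 4 + real n + 1\<rfloor> = \<lfloor>(real n)\<^sup>2 / 4\<rfloor> + int n + 1"
    by (metis floor_add_int floor_one of_int_1 of_int_of_nat_eq)
  moreover have "(real n)\<^sup>2 / 4 = real (n * n) / real 4" by (simp add: power2_eq_square)
  ultimately show ?thesis by (simp add: floor_divide_of_nat_eq min_lines_def del: of_nat_mult of_nat_numeral)
qed

text \<open>Completing the square in \<open>p\<close>; the factor 4 clears denominators.\<close>

lemma four_broom_lines:
  assumes "p \<le> n"
  shows "4 * int (broom_lines n p) = (2 * int p - int n + 1)\<^sup>2 + int n * int n + 4 * int n + 3"
proof -
  have "2 * int (p + 1 choose 2) = (int p + 1) * int p"
    using choose_two_int[of "p + 1"] by simp
  moreover have "2 * int (n - p + 1 choose 2) = (int n - int p + 1) * (int n - int p)"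
    using choose_two_int[of "n - p + 1"] assms by (simp add: of_nat_diff)
  ultimately have "4 * int (broom_lines n p) =
      4 + 2 * ((int p + 1) * int p) + 2 * ((int n - int p + 1) * (int n - int p)) + 4 * int p"
    unfolding broom_lines_def by simp
  then show ?thesis by (simp add: power2_eq_square algebra_simps)
qed

lemma four_min_lines:
  "4 * int (min_lines n) = int n * int n + 4 * int n + (if odd n then 3 else 4)"
proof -
  have "int n * int n div 4 * 4 = int n * int n - (if odd n then 1 else 0)"
  proof (cases "odd n")
    case True
    then obtain k where "n = 2 * k + 1" by (rule oddE)
    then obtain x where "int n * int n = 1 + 4 * x"
      by (intro that[of "int k * int k + int k"]) (simp add: algebra_simps)
    moreover have "(1 + 4 * x) div 4 * 4 = 1 + 4 * x - 1" by presburger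
    ultimately show ?thesis using True by simp
  next
    case False
    then obtain k where "n = 2 * k" by (auto elim: evenE)
    then have "int n * int n = (int k * int k) * 4" by (simp add: algebra_simps)
    then show ?thesis using False by simp
  qed
  then show ?thesis unfolding min_lines_def by (simp add: zdiv_int split: if_splits)
qed

text \<open>Four times the difference is the square of \<open>?t\<close> for odd \<open>n\<close>,
  and that square minus one for even \<open>n\<close>. In the even case \<open>?t\<close> is odd, so
  the difference vanishes exactly if \<open>?t\<close> is 1 or -1.\<close>

lemma min_le_broom_lines:
  assumes "p \<le> n"
  shows "min_lines n \<le> broom_lines n p"
    "broom_lines n p = min_lines n \<longleftrightarrow>
      (if odd n then p = (n - 1) div 2 else p = n div 2 - 1 \<and> n > 0 \<or> p = n div 2)"
proof -
  let ?t = "2 * int p - int n + 1"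
  note a = four_broom_lines[OF assms] four_min_lines[of n]
  have "min_lines n \<le> broom_lines n p \<and> (broom_lines n p = min_lines n \<longleftrightarrow>
      (if odd n then p = (n - 1) div 2 else p = n div 2 - 1 \<and> n > 0 \<or> p = n div 2))"
  proof (cases "odd n")
    case True
    then obtain k where k: "n = 2 * k + 1" by (rule oddE)
    have "4 * int (broom_lines n p) = 4 * int (min_lines n) + ?t\<^sup>2" using a True by simp
    moreover have "?t\<^sup>2 \<ge> 0" "?t\<^sup>2 = 0 \<longleftrightarrow> p = k" using k by auto
    ultimately have "min_lines n \<le> broom_lines n p" "broom_lines n p = min_lines n \<longleftrightarrow> p = k"
      by linarith+
    then show ?thesis using True k by simp
  next
    case False
    then obtain k where k: "n = 2 * k" by (auto elim: evenE)
    have "?t \<noteq> 0" using k by presburger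
    then have "?t\<^sup>2 > 0" by simp
    moreover have "4 * int (broom_lines n p) = 4 * int (min_lines n) + ?t\<^sup>2 - 1" using a False by simp
    moreover have "?t\<^sup>2 = 1 \<longleftrightarrow> p = k \<or> p + 1 = k" using k unfolding power2_eq_1_iff by presburger
    ultimately have "min_lines n \<le> broom_lines n p"
      "broom_lines n p = min_lines n \<longleftrightarrow> p = k \<or> p + 1 = k" by linarith+
    moreover have "p + 1 = k \<longleftrightarrow> p = n div 2 - 1 \<and> n > 0" using k by auto
    ultimately show ?thesis using False k by auto
  qed
  then show "min_lines n \<le> broom_lines n p"
    "broom_lines n p = min_lines n \<longleftrightarrow>
      (if odd n then p = (n - 1) div 2 else p = n div 2 - 1 \<and> n > 0 \<or> p = n div 2)" by auto
qed

text \<open>Four times the difference is at least 6n - 1 - n^2, which is positive for n from 1 to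
  5.\<close>

lemma broom_lines_small:
  assumes "p \<le> n" "1 \<le> n" "n \<le> 5"
  shows "(n choose 2) + 1 < broom_lines n p"
proof -
  have "int n * int n + 1 < 6 * int n" using assms(2,3)
    by (auto simp: le_Suc_eq numeral_eq_Suc)
  moreover have "4 * int (n choose 2) = 2 * (int n * int n) - 2 * int n"
    using choose_two_int[of n] by (simp add: algebra_simps)
  moreover have "(2 * int p - int n + 1)\<^sup>2 \<ge> 0" by simp
  ultimately show ?thesis using four_broom_lines[OF assms(1)] by linarith
qed

text \<open>Four times the difference is at least n^2 - 6n.\<close>

lemma min_lines_le_choose:
  "n \<ge> 6 \<Longrightarrow> min_lines n \<le> (n choose 2) + 1" "n > 6 \<Longrightarrow> min_lines n < (n choose 2) + 1"
proof -
  have c: "4 * int (n choose 2) = 2 * (int n * int n) - 2 * int n"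
    using choose_two_int[of n] by (simp add: algebra_simps)
  have m: "4 * int (min_lines n) \<le> int n * int n + 4 * int n + 4"
    using four_min_lines[of n] by auto
  show "min_lines n \<le> (n choose 2) + 1" if "n \<ge> 6"
  proof -
    have "6 * int n \<le> int n * int n" using that by (intro mult_right_mono) auto
    then show ?thesis using c m by linarith
  qed
  show "min_lines n < (n choose 2) + 1" if "n > 6"
  proof -
    have "7 * int n \<le> int n * int n" using that by (intro mult_right_mono) auto
    then show ?thesis using c m that by linarith
  qed
qed

lemma min_lines_6: "min_lines 6 = (6 choose 2) + 1"
  by (simp add: min_lines_def choose_two)

section \<open>The number of lines of an arbitrary tree\<close>

context tree_metric
begin

definition line_count :: nat where "line_count = card (red_line ` pairs V) + card (blue_line ` pairs V)"

lemma lines_eq: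
  assumes "\<And>u v p. u \<in> V \<Longrightarrow> v \<in> V \<Longrightarrow> p \<in> V \<Longrightarrow> u \<noteq> v \<Longrightarrow> p \<noteq> u \<Longrightarrow> p \<noteq> v \<Longrightarrow>
    f {u, v, p} = Red \<longleftrightarrow> col u v p"
  shows "num_lines (V, f) = line_count"
proof -
  have blue: "x = Blue \<longleftrightarrow> x \<noteq> Red" for x by (cases x) auto
  have red_line: "line (V, f) Red u v = red_line {u, v}" if uv: "u \<in> V" "v \<in> V" "u \<noteq> v" for u v
  proof -
    have "col u v u" "col u v v" using d_refl uv by simp_all
    then have "p \<in> line (V, f) Red u v \<longleftrightarrow> p \<in> V \<and> col u v p" for p
      using assms[of u v p] uv unfolding line_def fst_conv snd_conv by blast
    then show ?thesis unfolding red_line_doubleton[OF uv(1,2)] by blast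
  qed
  have blue_line: "line (V, f) Blue u v = blue_line {u, v}" if uv: "u \<in> V" "v \<in> V" "u \<noteq> v" for u v
  proof -
    have "p \<in> line (V, f) Blue u v \<longleftrightarrow> p \<in> blue_line {u, v}" for p
    proof (cases "p \<in> V")
      case True
      then show ?thesis using assms[of u v p] uv blue_line_iff[of u v p] blue
        unfolding line_def fst_conv snd_conv by blast
    next
      case False
      then show ?thesis using uv by (auto simp: line_def blue_line_def)
    qed
    then show ?thesis by blast
  qed
  have im: "lines (V, f) k = F ` pairs V"
    if "\<And>u v. u \<in> V \<Longrightarrow> v \<in> V \<Longrightarrow> u \<noteq> v \<Longrightarrow> line (V, f) k u v = F {u, v}" for k F
  proof
    show "lines (V, f) k \<subseteq> F ` pairs V"
      using that unfolding lines_def fst_conv by (force simp: image_iff)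
    show "F ` pairs V \<subseteq> lines (V, f) k"
    proof
      fix l assume "l \<in> F ` pairs V"
      then obtain e where "e \<in> pairs V" "l = F e" by blast
      then obtain u v where "l = F {u, v}" "u \<noteq> v" "u \<in> V" "v \<in> V" unfolding pairs_iff by blast
      then show "l \<in> lines (V, f) k" using that unfolding lines_def fst_conv by blast
    qed
  qed
  show ?thesis unfolding num_lines_def line_count_def
    using im[OF red_line] im[OF blue_line] by simp
qed

lemma line_count_path: "card leaves = 2 \<Longrightarrow> line_count = (card V choose 2) + 1"
  using two_leaves_lines by (simp add: line_count_def)

lemma card_supports:
  "card supports \<le> card leaves" "card supports \<ge> 1" "card supports < card leaves \<Longrightarrow> card twin_supports \<ge> 1"
proof -
  show "card supports \<le> card leaves" unfolding supports_def using finite_leaves by (rule card_image_le)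
  have "supports \<noteq> {}" "finite supports" using card_leaves finite_leaves by (auto simp: supports_def)
  then show "card supports \<ge> 1" by (simp add: Suc_le_eq card_gt_0_iff)
  have "finite twin_supports" by (rule finite_subset[OF _ \<open>finite supports\<close>]) (use sec(4) in blast)
  show "card twin_supports \<ge> 1" if less: "card supports < card leaves"
  proof -
    have "\<not> inj_on nb leaves" using less card_image[of nb leaves] by (auto simp: supports_def)
    then have "twin_supports \<noteq> {}" unfolding inj_on_def twin_supports_def by blast
    then show ?thesis using \<open>finite twin_supports\<close> by (simp add: Suc_le_eq card_gt_0_iff)
  qed
qed

text \<open>If no two leaves share a neighbour, all pairs generate different blue lines and there
  are at least four red ones. For a star the bounds add up to \<open>(card V choose 2) + 2\<close>.
  Every other tree is compared with a broom.\<close>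

lemma line_count_lower:
  assumes "card leaves \<ge> 3"
  shows "line_count \<ge> (card V choose 2) + 2 \<or>
    (\<exists>p \<le> card V. 2 \<le> p \<and> line_count \<ge> broom_lines (card V) p \<and>
      (line_count = broom_lines (card V) p \<longrightarrow> (\<exists>c z P. broom c z P \<and> card P = p)))"
proof -
  let ?n = "card V" and ?l = "card leaves" and ?s = "card supports"
  have line_count: "line_count \<ge> 1 + (?l choose 2) + ((?n - ?l + ?s choose 2) + (?l - ?s) + card twin_supports)"
    using red_lower[OF assms] blue_lower unfolding line_count_def by linarith
  have ln: "?l \<le> ?n" using leaves_subset fin by (rule card_mono[rotated])
  have s: "?s \<le> ?l" "?s \<ge> 1" "?s < ?l \<Longrightarrow> card twin_supports \<ge> 1" using card_supports by auto
  consider "?s = ?l" | "?s < ?l" "?s = 1" | "?s < ?l" "?s \<ge> 2" using s by linarith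
  then show ?thesis
  proof cases
    case 1
    have "(?l choose 2) \<ge> (3 choose 2)" using assms by (rule binomial_right_mono)
    then have "(?l choose 2) \<ge> 3" by (simp add: choose_two)
    then show ?thesis using line_count 1 ln by simp
  next
    case 2
    have n: "?n = ?l + 1" using one_support 2 by blast
    then have "?n choose 2 = (?l choose 2) + ?l" by (simp add: numeral_2_eq_2)
    moreover have "?n - ?l + ?s choose 2 = 1" using n 2 by (simp add: numeral_2_eq_2)
    moreover have "card twin_supports \<ge> 1" using 2 s by blast
    ultimately have "line_count \<ge> (?n choose 2) + 2" using line_count 2 by linarith
    then show ?thesis by blast
  next
    case 3
    \<comment> \<open>With this \<open>p\<close> the blue bound already has the broom's form, and
      the red one is least if \<open>card leaves = p + 1\<close>, that is if there are two
      supports.\<close>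
    define p where "p = ?l - ?s + 1"
    have p: "p \<le> ?n" "2 \<le> p" "?n - ?l + ?s = ?n - p + 1" "?l - ?s = p - 1" "p + 1 \<le> ?l"
      using 3 ln by (auto simp: p_def)
    have mono: "(p + 1 choose 2) \<le> (?l choose 2)" using p(5) by (rule binomial_right_mono)
    have lower: "line_count \<ge> broom_lines ?n p"
      using line_count p s(3)[OF 3(1)] mono unfolding broom_lines_def p(3,4) by linarith
    \<comment> \<open>Equality leaves no slack: there is one twin support, and more than p + 1
      leaves would add further red lines.\<close>
    have "\<exists>c z P. broom c z P \<and> card P = p" if eq: "line_count = broom_lines ?n p"
    proof -
      have twin_supports: "card twin_supports = 1" using line_count p s(3)[OF 3(1)] mono eq unfolding broom_lines_def p(3,4) by linarith
      have "(?l choose 2) \<le> (p + 1 choose 2)" using line_count p twin_supports eq unfolding broom_lines_def p(3,4) by linarith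
      have "?s = 2"
      proof (rule ccontr)
        assume "?s \<noteq> 2"
        then have "p + 2 \<le> ?l" using 3 by (auto simp: p_def)
        then have "(p + 2 choose 2) \<le> (?l choose 2)" by (rule binomial_right_mono)
        moreover have "(p + 2 choose 2) = (p + 1 choose 2) + (p + 1)" by (simp add: numeral_2_eq_2)
        ultimately show False using \<open>(?l choose 2) \<le> (p + 1 choose 2)\<close> by linarith
      qed
      then obtain c z P where b: "broom c z P" using broomI twin_supports assms by blast
      have "card leaves = Suc (card P)"
        using broom_simps(1,2,8)[OF b] by (metis card_insert_disjoint)
      then have "card P = p" using \<open>?s = 2\<close> 3 by (simp add: p_def)
      then show ?thesis using b by blast
    qed
    then show ?thesis using p lower by blast
  qed
qed

text \<open>For a handle of \<open>k\<close> vertices, the blue lines \<open>V - {c}\<close> and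
  \<open>insert v P\<close> number at most \<open>k\<close>, and Pascal's rule merges them with
  \<open>k choose 2\<close>.\<close>

lemma line_count_broom:
  assumes "broom c z P"
  shows "line_count \<le> broom_lines (card V) (card P)"
proof -
  note b = broom_simps[OF assms]
  have l: "card leaves = card P + 1" using b(1,2,8) by (metis Suc_eq_plus1 card_insert_disjoint)
  have VP: "card (V - P) = card V - card P" using b(7,8) by (rule card_Diff_subset[rotated])
  have "c \<in> V - P" using b by blast
  then have "card (V - P) \<ge> 1" using fin by (auto simp: Suc_le_eq card_gt_0_iff)
  then have "line_count \<le> 1 + (card P + 1 choose 2) + (card (V - P) + card P + (card (V - P) choose 2))"
    using broom_upper[OF assms] unfolding line_count_def l by linarith
  moreover have "(card (V - P) + 1 choose 2) = card (V - P) + (card (V - P) choose 2)"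
    by (simp add: numeral_2_eq_2)
  ultimately show ?thesis unfolding broom_lines_def VP by linarith
qed

text \<open>A tree is a path, has more lines than a path, or has at least as many as the formula for
  some broom. Comparing the formulas, the path wins up to n = 5, brooms win from n = 7 on, and they
  tie at n = 6.\<close>

lemma line_count_bounds:
  defines "n \<equiv> card V"
  shows "n \<ge> 6 \<Longrightarrow> line_count \<ge> min_lines n" "n \<le> 6 \<Longrightarrow> line_count \<ge> (n choose 2) + 1"
    "n \<le> 5 \<Longrightarrow> line_count = (n choose 2) + 1 \<Longrightarrow> card leaves = 2"
    "n \<ge> 6 \<Longrightarrow> line_count = min_lines n \<Longrightarrow> n = 6 \<and> card leaves = 2 \<or>
      (\<exists>c z P. broom c z P \<and> broom_lines n (card P) = min_lines n)"
proof -
  have l: "card leaves = 2 \<or> card leaves \<ge> 3" using card_leaves by linarith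
  have n3: "n \<ge> 3" using card_V n_def by simp
  have dich: "card leaves = 2 \<and> line_count = (n choose 2) + 1 \<or> line_count \<ge> (n choose 2) + 2 \<or>
    (\<exists>p \<le> n. line_count \<ge> broom_lines n p \<and> (line_count = broom_lines n p \<longrightarrow> (\<exists>c z P. broom c z P \<and> card P = p)))"
    using l line_count_path line_count_lower unfolding n_def by blast
  show "line_count \<ge> min_lines n" if "n \<ge> 6"
    using dich min_lines_le_choose(1)[OF that] min_le_broom_lines(1) by fastforce
  show "line_count \<ge> (n choose 2) + 1" if "n \<le> 6"
  proof (cases "n = 6")
    case True
    then show ?thesis using dich min_lines_6 min_le_broom_lines(1)[of _ 6] by fastforce
  next
    case False
    then show ?thesis using dich broom_lines_small[of _ n] that n3 by fastforce
  qed
  show "card leaves = 2" if "n \<le> 5" "line_count = (n choose 2) + 1"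
    using dich broom_lines_small[of _ n] that n3 by fastforce
  show "n = 6 \<and> card leaves = 2 \<or> (\<exists>c z P. broom c z P \<and> broom_lines n (card P) = min_lines n)"
    if n6: "n \<ge> 6" and eq: "line_count = min_lines n"
  proof -
    have le: "n > 6 \<Longrightarrow> line_count < (n choose 2) + 1" "line_count \<le> (n choose 2) + 1"
      using min_lines_le_choose n6 eq by auto
    consider "card leaves = 2" "line_count = (n choose 2) + 1" | "line_count \<ge> (n choose 2) + 2"
      | p where "p \<le> n" "line_count \<ge> broom_lines n p"
        "line_count = broom_lines n p \<longrightarrow> (\<exists>c z P. broom c z P \<and> card P = p)"
      using dich by blast
    then show ?thesis
    proof cases
      case 1
      then have "n = 6" using le n6 by linarith
      then show ?thesis using 1 by blast
    next
      case 2
      then show ?thesis using le(2) by linarith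
    next
      case 3
      then have "line_count = broom_lines n p" using min_le_broom_lines(1)[OF 3(1)] eq by linarith
      then show ?thesis using 3(3) eq by metis
    qed
  qed
qed

text \<open>The graph enters only through adjacency and the colouring only through collinearity.
  Isomorphism with a path is recognized by having two leaves, isomorphism with some
  \<open>S_tree\<close> by being a broom.\<close>

theorem num_lines_graph:
  fixes T :: "'a graph" and f :: "'a set \<Rightarrow> colour"
  assumes verts: "verts T = V"
    and edge: "\<And>u v. u \<in> V \<Longrightarrow> v \<in> V \<Longrightarrow> d u v = 1 \<longleftrightarrow> {u, v} \<in> edges T"
    and colour: "\<And>u v p. u \<in> V \<Longrightarrow> v \<in> V \<Longrightarrow> p \<in> V \<Longrightarrow> u \<noteq> v \<Longrightarrow> p \<noteq> u \<Longrightarrow> p \<noteq> v \<Longrightarrow>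
      f {u, v, p} = Red \<longleftrightarrow> col u v p"
    and n: "card V = n" and m: "m = num_lines (V, f)"
  shows "(n \<ge> 6 \<longrightarrow> int m \<ge> \<lfloor>(real n)\<^sup>2 / 4 + real n + 1\<rfloor>) \<and>
         (n \<le> 6 \<longrightarrow> m \<ge> (n choose 2) + 1) \<and>
         ((n \<ge> 6 \<longrightarrow> int m = \<lfloor>(real n)\<^sup>2 / 4 + real n + 1\<rfloor>) \<and>
          (n \<le> 6 \<longrightarrow> m = (n choose 2) + 1)
          \<longleftrightarrow>
          (n \<le> 6 \<and> graph_iso T (path_graph n)) \<or>
          (n \<ge> 6 \<and> (\<exists>a. (if odd n then a = (n - 1) div 2 else a = n div 2 - 1 \<or> a = n div 2) \<and>
                        graph_iso T (S_tree a (n - a)))))"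
proof -
  have m: "m = line_count" using lines_eq[OF colour] m by simp
  have n3: "n \<ge> 3" using card_V n by simp
  have path: "graph_iso T (path_graph n) \<longleftrightarrow> card leaves = 2"
  proof
    assume "graph_iso T (path_graph n)"
    then obtain h where h: "bij_betw h V {..<n}"
      "\<forall>u \<in> V. \<forall>v \<in> V. {u, v} \<in> edges T \<longleftrightarrow> {h u, h v} \<in> edges (path_graph n)"
      unfolding graph_iso_def verts by (auto simp: path_graph_def)
    show "card leaves = 2" by (rule path_iso_card_leaves[OF h(1)]) (use h(2) edge in blast)
  next
    assume "card leaves = 2"
    then obtain a b where ab: "a \<in> V" "b \<in> V" "{y \<in> V. btw a y b} = V" by (rule two_leaves)
    note gi = geodesic_index[OF ab(1,2), unfolded ab(3) n]
    have "{u, v} \<in> edges T \<longleftrightarrow> {d a u, d a v} \<in> edges (path_graph n)"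
      if "u \<in> V" "v \<in> V" for u v
    proof -
      have "d a u < n" "d a v < n" using bij_betwE[OF gi(1)] that by auto
      then show ?thesis using gi(2)[OF that] edge[OF that] path_graph_edge_iff by blast
    qed
    moreover have "verts (path_graph n) = {..<n}" by (simp add: path_graph_def)
    ultimately show "graph_iso T (path_graph n)" unfolding graph_iso_def verts using gi(1) by metis
  qed
  have S_verts: "verts (S_tree p q) = {..<q + p}" for p q by (simp add: S_tree_def)
  have S_of_broom: "graph_iso T (S_tree (card P) (n - card P))" if b: "broom c z P" for c z P
  proof -
    have "card (V - P) = n - card P"
      using broom_simps(7,8)[OF b] n by (simp add: card_Diff_subset)
    from broom_iso[OF b this[symmetric] refl] edge show ?thesis
      unfolding graph_iso_def S_verts verts by metis
  qed
  have broom_of_S: "m \<le> broom_lines n a" if a: "a \<ge> 2" "n - a \<ge> 2" and iso: "graph_iso T (S_tree a (n - a))" for a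
  proof -
    obtain h where h: "bij_betw h V {..<(n - a) + a}"
      "\<forall>u \<in> V. \<forall>v \<in> V. {u, v} \<in> edges T \<longleftrightarrow> {h u, h v} \<in> edges (S_tree a (n - a))"
      using iso unfolding graph_iso_def S_verts verts by blast
    obtain c z P where "broom c z P" "card P = a"
      by (rule S_tree_iso_broom[OF a h(1)]) (use h(2) edge in blast)+
    then show ?thesis using line_count_broom m n by blast
  qed
  note B = line_count_bounds[unfolded n]
  have opt: "broom_lines n a = min_lines n \<longleftrightarrow>
    (if odd n then a = (n - 1) div 2 else a = n div 2 - 1 \<or> a = n div 2)" if "a \<le> n" for a
    using min_le_broom_lines(2)[OF that] n3 by auto
  \<comment> \<open>Both formulas give 16 here, so the two conditions in \<open>?eq\<close> agree
    and both kinds of trees are extremal.\<close>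
  have six: "min_lines n = (n choose 2) + 1" if "n = 6" using min_lines_6 that by simp
  let ?eq = "(n \<ge> 6 \<longrightarrow> m = min_lines n) \<and> (n \<le> 6 \<longrightarrow> m = (n choose 2) + 1)"
  let ?star = "\<exists>a. (if odd n then a = (n - 1) div 2 else a = n div 2 - 1 \<or> a = n div 2) \<and>
                        graph_iso T (S_tree a (n - a))"
  have "?eq \<longleftrightarrow> n \<le> 6 \<and> graph_iso T (path_graph n) \<or> n \<ge> 6 \<and> ?star"
  proof
    assume e: ?eq
    show "n \<le> 6 \<and> graph_iso T (path_graph n) \<or> n \<ge> 6 \<and> ?star"
    proof (cases "n \<ge> 6")
      case False
      then show ?thesis using e B(3) m path by auto
    next
      case True
      then have "line_count = min_lines n" using e m by simp
      from B(4)[OF True this] consider "n = 6" "card leaves = 2"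
        | c z P where "broom c z P" "broom_lines n (card P) = min_lines n"
        by blast
      then show ?thesis
      proof cases
        case 1
        then show ?thesis using path by blast
      next
        case 2
        have "card P \<le> n" using broom_simps(7)[OF 2(1)] n fin card_mono by blast
        then show ?thesis using opt 2 S_of_broom True by blast
      qed
    qed
  next
    assume "n \<le> 6 \<and> graph_iso T (path_graph n) \<or> n \<ge> 6 \<and> ?star"
    then show ?eq
    proof
      assume "n \<le> 6 \<and> graph_iso T (path_graph n)"
      then have "n \<le> 6" "m = (n choose 2) + 1" using path line_count_path m n by auto
      then show ?eq using six by auto
    next
      assume *: "n \<ge> 6 \<and> ?star"
      then obtain a where a: "if odd n then a = (n - 1) div 2 else a = n div 2 - 1 \<or> a = n div 2"
        "graph_iso T (S_tree a (n - a))" by blast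
      have n6: "n \<ge> 6" using * by blast
      \<comment> \<open>From \<open>n \<ge> 6\<close> both parameters of \<open>S_tree\<close> are
        at least 2, as \<open>S_tree_iso_broom\<close> demands.\<close>
      have range: "a \<ge> 2" "n - a \<ge> 2" "a \<le> n" using a(1) n6 by (auto split: if_splits)
      have "m \<le> min_lines n" using broom_of_S[OF range(1,2) a(2)] iffD2[OF opt[OF range(3)] a(1)] by simp
      then have "m = min_lines n" using B(1) n6 m by simp
      then show ?eq using six n6 by (cases "n = 6") auto
    qed
  qed
  then show ?thesis unfolding floor_min_lines using B(1,2) m by simp
qed

end

section \<open>Derived systems of weighted trees\<close>

context tree
begin

lemma tree_metric_gdist:
  assumes "card V \<ge> 3"
  shows "tree_metric V gdist"
proof (rule tree_metric.intro)
  show "finite V" using tree by (simp add: is_tree_def simple_graph_def)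
qed (fact assms gdist_0 gdist_sym gdist_median gdist_between gdist_step)+

text \<open>The weighted and the unweighted equation both say that the middle vertex lies on the
  path between the other two, so the weights drop out. Namings of the triple differ in which vertex
  is \<open>b\<close> and in the order of the outer ones.\<close>

lemma derived_colour:
  assumes w: "\<forall>e \<in> edges G. w e > 0"
    and V: "u \<in> V" "v \<in> V" "p \<in> V" and ne: "u \<noteq> v" "p \<noteq> u" "p \<noteq> v"
  shows "snd (derived_system G w) {u, v, p} = Red \<longleftrightarrow>
    gdist u p = gdist u v + gdist v p \<or> gdist v p = gdist v u + gdist u p \<or>
    gdist u v = gdist u p + gdist p v"
proof -
  let ?btw = "\<lambda>a b c. gdist a c = gdist a b + gdist b c"
  have add: "tree_dist G w a b + tree_dist G w b c = tree_dist G w a c \<longleftrightarrow> ?btw a b c"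
    if "a \<in> V" "b \<in> V" "c \<in> V" for a b c
    using tree_dist_add_iff[of a c b w] gdist_add_iff[of a c b] that w by blast
  have "(\<exists>a b c. {u, v, p} = {a, b, c} \<and>
      tree_dist G w a b + tree_dist G w b c = tree_dist G w a c) \<longleftrightarrow>
      ?btw u v p \<or> ?btw v u p \<or> ?btw u p v" (is "?E \<longleftrightarrow> _")
  proof
    assume ?E
    then obtain a b c where abc: "{u, v, p} = {a, b, c}"
        "tree_dist G w a b + tree_dist G w b c = tree_dist G w a c" by blast
    have "{a, b, c} \<subseteq> V" unfolding abc(1)[symmetric] using V by simp
    then have abcV: "a \<in> V" "b \<in> V" "c \<in> V" by simp_all
    \<comment> \<open>This excludes degenerate namings such as \<open>a = b\<close>, for which the
      equation would hold trivially.\<close>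
    have "card {a, b, c} = 3" unfolding abc(1)[symmetric] using ne by simp
    then have "b \<noteq> a" "b \<noteq> c" by (auto simp: card_insert_if split: if_splits)
    then have ac: "{a, c} = {u, v, p} - {b}" unfolding abc(1) by auto
    have "?btw a b c" using abcV add abc(2) by blast
    moreover from this have "?btw c b a" using abcV gdist_sym by (metis add.commute)
    moreover have "b \<in> {u, v, p}" unfolding abc(1) by simp
    then have "b = u \<or> b = v \<or> b = p" by simp
    moreover have "{a, c} = {v, p}" if "b = u" using ac ne that by simp
    moreover have "{a, c} = {u, p}" if "b = v" using ac ne that by auto
    moreover have "{a, c} = {u, v}" if "b = p" using ac ne that by auto
    ultimately show "?btw u v p \<or> ?btw v u p \<or> ?btw u p v" unfolding doubleton_eq_iff by blast
  next
    assume "?btw u v p \<or> ?btw v u p \<or> ?btw u p v"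
    then consider "?btw u v p" | "?btw v u p" | "?btw u p v" by blast
    then show ?E
    proof cases
      case 1
      then show ?thesis using add[of u v p] V by blast
    next
      case 2
      then have "{u, v, p} = {v, u, p} \<and>
        tree_dist G w v u + tree_dist G w u p = tree_dist G w v p" using add[of v u p] V by blast
      then show ?thesis by blast
    next
      case 3
      then have "{u, v, p} = {u, p, v} \<and>
        tree_dist G w u p + tree_dist G w p v = tree_dist G w u v" using add[of u p v] V by blast
      then show ?thesis by blast
    qed
  qed
  then show ?thesis unfolding derived_system_def snd_conv by simp
qed

end

theorem theorem4:
  fixes T :: "'a graph" and w :: "'a set \<Rightarrow> real" and n :: nat
  assumes "n \<ge> 3"
    and "is_tree T"
    and "card (verts T) = n"
    and "\<forall>e \<in> edges T. w e > 0"
  defines "m \<equiv> num_lines (derived_system T w)"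
  shows "(n \<ge> 6 \<longrightarrow> int m \<ge> \<lfloor>(real n)\<^sup>2 / 4 + real n + 1\<rfloor>) \<and>
         (n \<le> 6 \<longrightarrow> m \<ge> (n choose 2) + 1) \<and>
         ((n \<ge> 6 \<longrightarrow> int m = \<lfloor>(real n)\<^sup>2 / 4 + real n + 1\<rfloor>) \<and>
          (n \<le> 6 \<longrightarrow> m = (n choose 2) + 1)
          \<longleftrightarrow>
          (n \<le> 6 \<and> graph_iso T (path_graph n)) \<or>
          (n \<ge> 6 \<and> (\<exists>a. (if odd n then a = (n - 1) div 2 else a = n div 2 - 1 \<or> a = n div 2) \<and>
                        graph_iso T (S_tree a (n - a)))))"
proof -
  have T: "tree T" using assms(2) by (rule tree.intro)
  have "tree_metric (verts T) (tree.gdist T)"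
    using tree.tree_metric_gdist[OF T] assms(1,3) by blast
  then show ?thesis
  proof (rule tree_metric.num_lines_graph[where f = "snd (derived_system T w)"])
    show "tree.gdist T u v = 1 \<longleftrightarrow> {u, v} \<in> edges T" if "u \<in> verts T" "v \<in> verts T" for u v
      by (rule tree.gdist_1[OF T that])
    show "m = num_lines (verts T, snd (derived_system T w))"
      by (simp add: m_def derived_system_def)
  qed (use assms(3) tree.derived_colour[OF T assms(4)] in blast)+
qed

end
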